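(* Assume that the family of conformity scores $\mathfrak{C}$ is stable and that the sequence $(\mathcal{C}_n(t_{n+1},\mathcal{T}_n))_{n\in\mathbb{N}}$ is stochastically bounded. Then $\delta$-inflated full conformal prediction sets are asymptotically uniformly conditionally conservative, that is, for every $\delta>0$ and every $\epsilon>0$, $$\lim_{n\to\infty}\mathbb{P}\Big(\sup_{\alpha\in[0,1]}\big[\mathbb{P}(y_{n+1}\notin PS^{\mathrm{fc}}_{n,\alpha}(\delta)\,\|\,\mathcal{T}_n)-\alpha\big]\ge\epsilon\Big)=0 .$$
   Context: Setting. For every $n\in\mathbb{N}$, $P_n$ is a regular Borel probability measure on $\mathcal{Z}_n=\mathcal{Y}_n\times\mathcal{X}_n$, where $\mathcal{Y}_n\subseteq\mathbb{R}$ is a (possibly unbounded) interval and $\mathcal{X}_n$ is a Euclidean space of dimension $p_n\in\mathbb{N}$. For each $n$, $t_i=t_i^{(n)}=(y_i,x_i)$, $1\le i\le n+1$, are i.i.d. with distribution $P_n$ (which may depend on $n$). Put $\mathcal{T}_n=(t_1,\dots,t_n)$, and let $\mathcal{T}_n^{\setminus i}$ denote $\mathcal{T}_n$ with $t_i$ removed. $\mathbb{P}(\cdot\,\|\,\mathcal{T}_n)$ denotes conditional probability given $\mathcal{T}_n$. Conformity scores. $\mathfrak{C}=(\mathcal{C}^{(n)}_m)_{n,m\in\mathbb{N}}$ is a family of measurable functions $\mathcal{C}^{(n)}_m:\mathcal{Z}_n\times\mathcal{Z}_n^m\to\mathbb{R}$ that are symmetric in their second argument (invariant under permutations of the $m$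 entries); the superscript $(n)$ is dropped, so for sample size $n$ one writes $\mathcal{C}_m$. $\mathfrak{C}$ is called stable if $|\mathcal{C}_n(t_{n+1},\mathcal{T}_n)-\mathcal{C}_{n-1}(t_{n+1},\mathcal{T}_n^{\setminus n})|\to 0$ in probability as $n\to\infty$. Quantiles. For a cdf $F$ and $\alpha\in\mathbb{R}$, $F^{-1}(\alpha)=\inf\{x\in\mathbb{R}:F(x)\ge\alpha\}\in[-\infty,\infty]$ with $\inf\emptyset=+\infty$ (so it is $-\infty$ for $\alpha\le0$ and $+\infty$ for $\alpha>1$). Full conformal prediction sets. For $y\in\mathcal{Y}_n$ let $\mathcal{D}_{n+1}^y=(t_1,\dots,t_n,(y,x_{n+1}))$ and, for $s\in\mathbb{R}$, $$\hat F_y(s)=\frac{1}{n+1}\mathds{1}\{\mathcal{C}_n((y,x_{n+1}),\mathcal{T}_n)\le s\}+\frac1{n+1}\sum_{i=1}^n\mathds{1}\{\mathcal{C}_n(t_i,\mathcal{D}_{n+1}^y\setminus t_i)\le s\},$$ where $\mathcal{D}_{n+1}^y\setminus t_i$ is $\mathcal{D}_{n+1}^y$ with its $i$-th entry removed. For $\alpha,\delta\in\mathbb{R}$, $$PS^{\mathrm{fc}}_{n,\alpha}(\delta)=\{y\in\mathcal{Y}_n:\mathcal{C}_n((y,x_{n+1}),\mathcal{T}_n)\le\hat F_y^{-1}(1-\alpha)+\delta\},$$ where $c\le+\infty$ is true and $c\le-\infty$ is false for real $c$. *)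

theory Defs
  imports "HOL-Probability.Probability"
begin

section \<open>Observations and samples\<close>

text \<open>
  The dimension \<open>p\<close> of the feature space varies with the sample size, so
  \<open>p\<close>-dimensional Euclidean space is rendered by extensional functions on \<open>{..<p}\<close>;
  the product \<open>\<sigma>\<close>-algebra is its Borel \<open>\<sigma>\<close>-algebra. Similarly, \<open>m\<close>-tuples of
  observations are extensional functions on \<open>{1..m}\<close>. A finite Borel measure on
  the Polish space \<open>Y \<times> \<real>\<^sup>p\<close>, \<open>Y\<close> an interval, is regular, so regularity
  need not be stated separately.
\<close>

type_synonym obs = "real \<times> (nat \<Rightarrow> real)"

definition obs_space :: "real set \<Rightarrow> nat \<Rightarrow> obs measure" where
  "obs_space Y p = restrict_space borel Y \<Otimes>\<^sub>M (\<Pi>\<^sub>M j\<in>{..<p}. borel)"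

definition tuple_space :: "'z measure \<Rightarrow> nat \<Rightarrow> (nat \<Rightarrow> 'z) measure" where
  "tuple_space Z m = (\<Pi>\<^sub>M i\<in>{1..m}. Z)"

definition sample :: "(nat \<Rightarrow> 'w \<Rightarrow> 'z) \<Rightarrow> nat \<Rightarrow> 'w \<Rightarrow> nat \<Rightarrow> 'z" where
  "sample t m \<omega> = (\<lambda>i\<in>{1..m}. t i \<omega>)"

text \<open>\<open>drop_entry m i \<tau>\<close> is the \<open>m\<close>-tuple \<open>\<tau>\<close> with its \<open>i\<close>-th entry removed, an
  \<open>(m - 1)\<close>-tuple.\<close>

definition drop_entry :: "nat \<Rightarrow> nat \<Rightarrow> (nat \<Rightarrow> 'z) \<Rightarrow> nat \<Rightarrow> 'z" where
  "drop_entry m i \<tau> = (\<lambda>j\<in>{1..m - 1}. if j < i then \<tau> j else \<tau> (j + 1))"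


section \<open>Conformity scores\<close>

type_synonym score = "obs \<Rightarrow> (nat \<Rightarrow> obs) \<Rightarrow> real"

definition conformity_score :: "obs measure \<Rightarrow> nat \<Rightarrow> score \<Rightarrow> bool" where
  "conformity_score Z m c \<longleftrightarrow>
     (\<lambda>(z, \<tau>). c z \<tau>) \<in> borel_measurable (Z \<Otimes>\<^sub>M tuple_space Z m) \<and>
     (\<forall>z \<in> space Z. \<forall>\<tau> \<in> space (tuple_space Z m). \<forall>\<pi>. \<pi> permutes {1..m} \<longrightarrow>
        c z (\<tau> \<circ> \<pi>) = c z \<tau>)"

text \<open>The random variables indexed by \<open>n\<close> may live on different probability spaces \<open>M n\<close>.\<close>

definition tends_to_0_in_prob :: "(nat \<Rightarrow> 'w measure) \<Rightarrow> (nat \<Rightarrow> 'w \<Rightarrow> real) \<Rightarrow> bool" where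
  "tends_to_0_in_prob M X \<longleftrightarrow>
     (\<forall>\<epsilon>>0. (\<lambda>n. measure (M n) {\<omega> \<in> space (M n). \<bar>X n \<omega>\<bar> > \<epsilon>}) \<longlonglongrightarrow> 0)"

definition stochastically_bounded :: "(nat \<Rightarrow> 'w measure) \<Rightarrow> (nat \<Rightarrow> 'w \<Rightarrow> real) \<Rightarrow> bool" where
  "stochastically_bounded M X \<longleftrightarrow>
     (\<forall>\<eta>>0. \<exists>B. \<forall>n. measure (M n) {\<omega> \<in> space (M n). \<bar>X n \<omega>\<bar> > B} \<le> \<eta>)"

text \<open>\<open>C n m\<close> is the score for sample size \<open>n\<close> with a training set of \<open>m\<close> observations.\<close>

definition stable_scores :: "(nat \<Rightarrow> 'w measure) \<Rightarrow> (nat \<Rightarrow> nat \<Rightarrow> 'w \<Rightarrow> obs) \<Rightarrow>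
    (nat \<Rightarrow> nat \<Rightarrow> score) \<Rightarrow> bool" where
  "stable_scores M t C \<longleftrightarrow>
     tends_to_0_in_prob M (\<lambda>n \<omega>.
       \<bar>C n n (t n (n + 1) \<omega>) (sample (t n) n \<omega>)
        - C n (n - 1) (t n (n + 1) \<omega>) (drop_entry n n (sample (t n) n \<omega>))\<bar>)"


section \<open>Full conformal prediction sets\<close>

definition quantile :: "(real \<Rightarrow> real) \<Rightarrow> real \<Rightarrow> ereal" where
  "quantile F \<alpha> = Inf (ereal ` {x. F x \<ge> \<alpha>})"

text \<open>\<open>\<tau>\<close> is the training sample of size \<open>n\<close>, \<open>x\<close> the new feature vector,
  \<open>y\<close> the candidate response and \<open>c\<close> the score for training sets of size \<open>n\<close>.\<close>

definition augmented :: "nat \<Rightarrow> (nat \<Rightarrow> obs) \<Rightarrow> (nat \<Rightarrow> real) \<Rightarrow> real \<Rightarrow> nat \<Rightarrow> obs" where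
  "augmented n \<tau> x y = \<tau>(n + 1 := (y, x))"

definition F_hat :: "score \<Rightarrow> nat \<Rightarrow> (nat \<Rightarrow> obs) \<Rightarrow> (nat \<Rightarrow> real) \<Rightarrow> real \<Rightarrow> real \<Rightarrow> real" where
  "F_hat c n \<tau> x y s =
     1 / real (n + 1) * of_bool (c (y, x) \<tau> \<le> s)
     + 1 / real (n + 1) *
       (\<Sum>i=1..n. of_bool (c (\<tau> i) (drop_entry (n + 1) i (augmented n \<tau> x y)) \<le> s))"

definition PS_fc :: "real set \<Rightarrow> score \<Rightarrow> nat \<Rightarrow> real \<Rightarrow> real \<Rightarrow> (nat \<Rightarrow> obs) \<Rightarrow>
    (nat \<Rightarrow> real) \<Rightarrow> real set" where
  "PS_fc Y c n \<alpha> \<delta> \<tau> x =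
     {y \<in> Y. ereal (c (y, x) \<tau>) \<le> quantile (F_hat c n \<tau> x y) (1 - \<alpha>) + ereal \<delta>}"

text \<open>The event of not covering the new response, as a set of samples
  \<open>(t\<^sub>1, \<dots>, t\<^sub>n\<^sub>+\<^sub>1)\<close>.\<close>

definition miscoverage :: "real set \<Rightarrow> nat \<Rightarrow> score \<Rightarrow> nat \<Rightarrow> real \<Rightarrow> real \<Rightarrow> (nat \<Rightarrow> obs) set" where
  "miscoverage Y p c n \<alpha> \<delta> =
     {d \<in> space (tuple_space (obs_space Y p) (n + 1)).
        fst (d (n + 1)) \<notin> PS_fc Y c n \<alpha> \<delta> (restrict d {1..n}) (snd (d (n + 1)))}"


section \<open>Conditional probability given the training sample\<close>

definition generated_algebra :: "'w measure \<Rightarrow> 'b measure \<Rightarrow> ('w \<Rightarrow> 'b) \<Rightarrow> 'w measure" where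
  "generated_algebra M S T = vimage_algebra (space M) T S"

text \<open>
  A regular conditional distribution of \<open>X\<close> given the sub-\<open>\<sigma>\<close>-algebra \<open>F\<close>. Conditional
  probabilities of an uncountable family of events must come from such a kernel before
  a supremum over the family is taken: versions chosen separately for each event
  could differ on uncountably many null sets.
\<close>

definition regular_cond_distr :: "'w measure \<Rightarrow> 'w measure \<Rightarrow> 'b measure \<Rightarrow> ('w \<Rightarrow> 'b) \<Rightarrow>
    ('w \<Rightarrow> 'b measure) \<Rightarrow> bool" where
  "regular_cond_distr M F S X K \<longleftrightarrow>
     K \<in> F \<rightarrow>\<^sub>M prob_algebra S \<and>
     (\<forall>A \<in> sets S. AE \<omega> in M.
        measure (K \<omega>) A = real_cond_exp M F (indicator (X -` A \<inter> space M)) \<omega>)"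


text \<open>For independent observations such a kernel exists: freeze the training sample and
  draw the new observation from its distribution.\<close>

lemma (in prob_space) regular_cond_distr_exists:
  assumes indep: "indep_vars (\<lambda>_. Z) t {1..n + 1}"
  shows "\<exists>K. regular_cond_distr M (generated_algebra M (tuple_space Z n) (sample t n))
               (tuple_space Z (n + 1)) (sample t (n + 1)) K"
proof -
  define T where "T = sample t n"
  define S where "S = tuple_space Z n"
  define S' where "S' = tuple_space Z (n + 1)"
  define F where "F = generated_algebra M S T"
  define Q where "Q = distr M Z (t (n + 1))"
  define K where "K = (\<lambda>\<omega>. distr Q S' (\<lambda>z. (T \<omega>)(n + 1 := z)))"
  have rv: "random_variable Z (t i)" if "i \<in> {1..n + 1}" for i
    using indep that by (auto simp: indep_vars_def)
  have T[measurable]: "T \<in> M \<rightarrow>\<^sub>M S"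
    unfolding T_def S_def sample_def tuple_space_def using rv by (auto intro!: measurable_restrict)
  have t[measurable]: "t (n + 1) \<in> M \<rightarrow>\<^sub>M Z" using rv by auto
  interpret Q: prob_space Q unfolding Q_def by (rule prob_space_distr) (rule t)
  have sQ[measurable_cong, simp]: "sets Q = sets Z" "space Q = space Z" by (auto simp: Q_def)
  have spF[simp]: "space F = space M" by (simp add: F_def generated_algebra_def)
  have TF[measurable]: "T \<in> F \<rightarrow>\<^sub>M S"
    unfolding F_def generated_algebra_def
    by (rule measurable_vimage_algebra1) (use measurable_space[OF T] in auto)
  have sub: "subalgebra M F"
    unfolding subalgebra_def spF F_def generated_algebra_def
    using measurable_sets[OF T] measurable_space[OF T] by (auto simp: sets_vimage_algebra2 Pi_iff)
  interpret finite_measure_subalgebra M F by unfold_locales (rule sub)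
  have upd[measurable]: "(\<lambda>(\<tau>, z). \<tau>(n + 1 := z)) \<in> S \<Otimes>\<^sub>M Z \<rightarrow>\<^sub>M S'"
  proof -
    have "{1..n + 1} = insert (n + 1) {1..n}" by auto
    then show ?thesis
      unfolding S_def S'_def tuple_space_def by (metis measurable_add_dim)
  qed
  have D: "sample t (n + 1) = (\<lambda>\<omega>. (T \<omega>)(n + 1 := t (n + 1) \<omega>))"
    by (auto simp: T_def sample_def fun_eq_iff)
  have Dm[measurable]: "sample t (n + 1) \<in> M \<rightarrow>\<^sub>M S'"
    unfolding D by measurable
  have Km: "K \<in> F \<rightarrow>\<^sub>M prob_algebra S'"
    unfolding K_def
  proof (rule measurable_distr_prob_space2)
    show "(\<lambda>_. Q) \<in> F \<rightarrow>\<^sub>M prob_algebra Z"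
      by (rule measurable_const) (auto simp: space_prob_algebra Q.prob_space_axioms)
    show "(\<lambda>(\<omega>, z). (T \<omega>)(n + 1 := z)) \<in> F \<Otimes>\<^sub>M Z \<rightarrow>\<^sub>M S'"
      by measurable
  qed
  have joint: "distr M (S \<Otimes>\<^sub>M Z) (\<lambda>\<omega>. (T \<omega>, t (n + 1) \<omega>)) = distr M S T \<Otimes>\<^sub>M Q"
  proof -
    define S1 where "S1 = PiM {n+1} (\<lambda>_. Z)"
    define U where "U = (\<lambda>\<omega>. restrict (\<lambda>i. t i \<omega>) {n+1})"
    have ev[measurable]: "(\<lambda>f. f (n + 1)) \<in> S1 \<rightarrow>\<^sub>M Z"
      unfolding S1_def by (rule measurable_component_singleton) auto
    have U[measurable]: "U \<in> M \<rightarrow>\<^sub>M S1"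
      unfolding U_def S1_def by (rule measurable_restrict) (use t in auto)
    have evU: "U \<omega> (n + 1) = t (n + 1) \<omega>" for \<omega>
      by (simp add: U_def)
    have "indep_var S T S1 U"
      unfolding S_def T_def S1_def U_def sample_def tuple_space_def
      by (rule indep_var_restrict[OF indep]) auto
    then have ind: "distr M S T \<Otimes>\<^sub>M distr M S1 U = distr M (S \<Otimes>\<^sub>M S1) (\<lambda>\<omega>. (T \<omega>, U \<omega>))"
      unfolding indep_var_distribution_eq by simp
    have Q': "Q = distr (distr M S1 U) Z (\<lambda>f. f (n + 1))"
      unfolding Q_def by (simp only: distr_distr[OF ev U] comp_def evU)
    have "distr M S T \<Otimes>\<^sub>M Q = distr (distr M S T) S (\<lambda>x. x) \<Otimes>\<^sub>M distr (distr M S1 U) Z (\<lambda>f. f (n + 1))"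
      unfolding Q' by (simp add: distr_id2)
    also have "\<dots> = distr (distr M S T \<Otimes>\<^sub>M distr M S1 U) (S \<Otimes>\<^sub>M Z) (\<lambda>(x, f). (x, f (n + 1)))"
      by (rule pair_measure_distr)
         (use ev in \<open>simp_all only: Q'[symmetric] Q.sigma_finite_measure_axioms
            measurable_distr_eq1 measurable_ident_sets\<close>)
    also have "\<dots> = distr M (S \<Otimes>\<^sub>M Z) (\<lambda>\<omega>. (T \<omega>, t (n + 1) \<omega>))"
      unfolding ind by (subst distr_distr) (measurable, simp only: comp_def case_prod_conv evU)
    finally show ?thesis by simp
  qed
  have "AE \<omega> in M. real_cond_exp M F (indicator (sample t (n + 1) -` A \<inter> space M)) \<omega> = measure (K \<omega>) A"
    if A[measurable]: "A \<in> sets S'" for A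
  proof (rule real_cond_exp_charact)
    show m: "(\<lambda>\<omega>. measure (K \<omega>) A) \<in> borel_measurable F"
      using measurable_compose[OF Km measurable_measure_prob_algebra[OF A]] .
    have m': "(\<lambda>\<omega>. measure (K \<omega>) A) \<in> borel_measurable M"
      using measurable_from_subalg[OF sub m] .
    have pK: "prob_space (K \<omega>)" if "\<omega> \<in> space M" for \<omega>
      using measurable_space[OF Km, of \<omega>] that by (auto simp: space_prob_algebra)
    show "integrable M (\<lambda>\<omega>. measure (K \<omega>) A)"
      by (rule integrable_const_bound[where B = 1])
         (use m' pK in \<open>auto intro!: AE_I2 prob_space.prob_le_1\<close>)
    show "integrable M (indicat_real (sample t (n + 1) -` A \<inter> space M))"
      using measurable_sets[OF Dm A] by (intro integrable_real_indicator) (auto simp: emeasure_eq_measure)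
    fix B' assume "B' \<in> sets F"
    then obtain B where B[measurable]: "B \<in> sets S" and B': "B' = T -` B \<inter> space M"
      unfolding F_def generated_algebra_def using measurable_space[OF T]
      by (auto simp: sets_vimage_algebra2 Pi_iff)
    have [measurable]: "B' \<in> sets M" unfolding B' by measurable
    let ?f = "\<lambda>(\<tau>, z). indicator B \<tau> * indicator A (\<tau>(n + 1 := z)) :: ennreal"
    have fm[measurable]: "?f \<in> borel_measurable (S \<Otimes>\<^sub>M Z)" by measurable
    have fm': "?f \<in> borel_measurable (distr M S T \<Otimes>\<^sub>M Q)"
      using fm by (simp cong: measurable_cong_sets sets_pair_measure_cong)
    have eK: "emeasure (K \<omega>) A = (\<integral>\<^sup>+z. indicator A ((T \<omega>)(n + 1 := z)) \<partial>Q)"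
      if "\<omega> \<in> space M" for \<omega>
    proof -
      have g: "(\<lambda>z. (T \<omega>)(n + 1 := z)) \<in> Q \<rightarrow>\<^sub>M S'"
        using measurable_compose[OF measurable_Pair1'[of "T \<omega>" S Z] upd] measurable_space[OF T that]
        by (simp cong: measurable_cong_sets)
      have "emeasure (K \<omega>) A = (\<integral>\<^sup>+x. indicator A x \<partial>(K \<omega>))"
        unfolding K_def by (simp)
      also have "\<dots> = (\<integral>\<^sup>+z. indicator A ((T \<omega>)(n + 1 := z)) \<partial>Q)"
        unfolding K_def by (rule nn_integral_distr[OF g]) simp
      finally show ?thesis .
    qed
    have "(\<integral>\<^sup>+\<omega>. ennreal (indicator B' \<omega> * indicator (sample t (n + 1) -` A \<inter> space M) \<omega>) \<partial>M)
        = (\<integral>\<^sup>+\<omega>. ?f (T \<omega>, t (n + 1) \<omega>) \<partial>M)"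
      by (rule nn_integral_cong) (auto simp: B' D[unfolded Suc_eq_plus1[symmetric]] indicator_def)
    also have "\<dots> = (\<integral>\<^sup>+x. ?f x \<partial>(distr M S T \<Otimes>\<^sub>M Q))"
      unfolding joint[symmetric]
      by (rule nn_integral_distr[OF measurable_Pair[OF T t], symmetric]) (use fm in simp)
    also have "\<dots> = (\<integral>\<^sup>+\<tau>. (\<integral>\<^sup>+z. ?f (\<tau>, z) \<partial>Q) \<partial>(distr M S T))"
      by (rule Q.nn_integral_fst[symmetric]) (rule fm')
    also have "\<dots> = (\<integral>\<^sup>+\<omega>. (\<integral>\<^sup>+z. ?f (T \<omega>, z) \<partial>Q) \<partial>M)"
      by (rule nn_integral_distr[OF T]) (use Q.borel_measurable_nn_integral_fst[OF fm'] in simp)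
    also have "\<dots> = (\<integral>\<^sup>+\<omega>. ennreal (indicator B' \<omega> * measure (K \<omega>) A) \<partial>M)"
    proof (rule nn_integral_cong)
      fix \<omega> assume w: "\<omega> \<in> space M"
      interpret k: prob_space "K \<omega>" by (rule pK[OF w])
      show "(\<integral>\<^sup>+z. ?f (T \<omega>, z) \<partial>Q) = ennreal (indicator B' \<omega> * measure (K \<omega>) A)"
        using eK[OF w] w by (auto simp: B' k.emeasure_eq_measure indicator_def)
    qed
    finally have eq: "(\<integral>\<^sup>+\<omega>. ennreal (indicator B' \<omega> * indicator (sample t (n + 1) -` A \<inter> space M) \<omega>) \<partial>M)
        = (\<integral>\<^sup>+\<omega>. ennreal (indicator B' \<omega> * measure (K \<omega>) A) \<partial>M)" .
    have mI: "(\<lambda>\<omega>. indicat_real B' \<omega> * indicat_real (sample t (Suc n) -` A \<inter> space M) \<omega>)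
        \<in> borel_measurable M"
      using measurable_sets[OF Dm A] by (intro borel_measurable_times borel_measurable_indicator) auto
    show "(LINT \<omega>:B'|M. indicat_real (sample t (n + 1) -` A \<inter> space M) \<omega>)
        = (LINT \<omega>:B'|M. measure (K \<omega>) A)"
      unfolding set_lebesgue_integral_def real_scaleR_def
      by (subst (1 2) integral_eq_nn_integral) (use eq m' mI in auto)
  qed
  then have "regular_cond_distr M F S' (sample t (n + 1)) K"
    unfolding regular_cond_distr_def using Km by (auto simp: eq_commute)
  then show ?thesis unfolding F_def S_def S'_def T_def by blast
qed

end

theory Submission
  imports Defs
begin

text \<open>
Let \<open>D = (t\<^sub>1, \<dots>, t\<^sub>n\<^sub>+\<^sub>1)\<close> be the sample augmented by the new observation,
\<open>R\<^sub>i = c\<^sub>n(t\<^sub>i, D \<setminus> t\<^sub>i)\<close> the leave-one-out scores, and \<open>G\<close> the conditional distribution function of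
\<open>R\<^sub>n\<^sub>+\<^sub>1\<close> given the training sample. Miscoverage at level \<open>\<alpha>\<close> means that
\<open>R\<^sub>n\<^sub>+\<^sub>1 - \<delta>\<close> exceeds the \<open>(1 - \<alpha>)\<close>-quantile of the empirical distribution \<open>F\<close> of \<open>R\<^sub>1, \<dots>, R\<^sub>n\<^sub>+\<^sub>1\<close>; hence
\<open>F(R\<^sub>n\<^sub>+\<^sub>1 - \<delta>) \<ge> 1 - \<alpha>\<close> (\<open>miscoverage_loo\<close>). If \<open>F\<close> could be replaced by \<open>G\<close>, at the cost of half
of \<open>\<delta>\<close> and a small \<open>e\<close>, then \<open>G(R\<^sub>n\<^sub>+\<^sub>1 - \<delta>/2) \<ge> 1 - \<alpha> - e\<close>, and that event has conditional probability at
most \<open>\<alpha> + e\<close>, whatever the distribution of the score (\<open>prob_cdf_shift_le\<close>).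

The replacement rests on a second moment bound (\<open>loo_mean_L2\<close>). For a Lipschitz function \<open>\<phi>\<close> with
values in \<open>[0, 1]\<close>, let \<open>A\<close> be the average of the \<open>\<phi>(R\<^sub>i)\<close> and \<open>B\<close> the conditional mean of \<open>\<phi>(R\<^sub>n\<^sub>+\<^sub>1)\<close>
given the training sample. By exchangeability, \<open>E A\<^sup>2\<close>, \<open>E A B\<close> and \<open>E B\<^sup>2\<close> are, up to \<open>O(1/n)\<close>, the
expectations of \<open>\<phi>(R\<^sub>n) \<phi>(R\<^sub>n\<^sub>+\<^sub>1)\<close>, \<open>\<phi>(R\<^sub>n) B\<close> and \<open>B \<phi>(R\<^sub>n\<^sub>+\<^sub>1)\<close>. Stability allows
\<open>R\<^sub>n\<close> and \<open>R\<^sub>n\<^sub>+\<^sub>1\<close> to be replaced by the scores of \<open>t\<^sub>n\<close> and \<open>t\<^sub>n\<^sub>+\<^sub>1\<close> trained on \<open>t\<^sub>1, \<dots>, t\<^sub>n\<^sub>-\<^sub>1\<close> only, and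
\<open>B\<close> by the corresponding conditional mean; given these observations, the two scores are independent and identically distributed,
so the three expectations differ by at most a multiple of the error of the replacement, and \<open>E (A - B)\<^sup>2\<close> tends
to \<open>0\<close>.

With \<open>\<phi>\<close> a continuous ramp in place of an indicator, \<open>A\<close> bounds \<open>F\<close> from above at the start of
the ramp, and \<open>B\<close> bounds \<open>G\<close> from below at its end. Since \<open>R\<^sub>n\<^sub>+\<^sub>1\<close> is stochastically bounded, finitely many ramps, in a number
that does not depend on \<open>n\<close>, suffice. Outside an event \<open>W\<close> of small probability, miscoverage at any level
is therefore contained in the event treated above; the conditional probability of \<open>W\<close> is controlled by
Markov's inequality (\<open>excess_miscoverage_bound\<close>).
\<close>

section \<open>Leave-one-out scores\<close>

text \<open>
  The score of the \<open>i\<close>-th of \<open>n + 1\<close> observations when trained on the \<open>n\<close> others. The case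
  \<open>i = n + 1\<close> is the score of the new observation given the training sample.
\<close>

definition loo_score :: "score \<Rightarrow> nat \<Rightarrow> nat \<Rightarrow> (nat \<Rightarrow> obs) \<Rightarrow> real" where
  "loo_score c n i d = c (d i) (drop_entry (n + 1) i d)"

text \<open>
  Mean of the \<open>n + 1\<close> leave-one-out scores.
\<close>

definition loo_mean :: "score \<Rightarrow> nat \<Rightarrow> (nat \<Rightarrow> obs) \<Rightarrow> real" where
  "loo_mean c n d = (\<Sum>i\<in>{1..n + 1}. loo_score c n i d) / real (n + 1)"

text \<open>
  Mean score of a fresh observation, given that the first \<open>n\<close> entries of \<open>d\<close> are the training sample; the
  remaining entries of \<open>d\<close> are ignored.
\<close>

definition train_mean :: "obs measure \<Rightarrow> score \<Rightarrow> nat \<Rightarrow> (nat \<Rightarrow> obs) \<Rightarrow> real" where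
  "train_mean P c n d = (\<integral>z. c z (restrict d {1..n}) \<partial>P)"

lemma drop_last_entry: "drop_entry m m d = restrict d {1..m - 1}"
  by (auto simp: drop_entry_def fun_eq_iff restrict_def)

lemma measurable_tuple_component:
  "i \<in> {1..m} \<Longrightarrow> (\<lambda>d. d i) \<in> tuple_space Z m \<rightarrow>\<^sub>M Z"
  unfolding tuple_space_def by (rule measurable_component_singleton)

lemma measurable_tuple_reindex:
  assumes "\<And>j. j \<in> {1..k} \<Longrightarrow> a j \<in> {1..m}"
  shows "(\<lambda>d. \<lambda>j\<in>{1..k}. d (a j)) \<in> tuple_space Z m \<rightarrow>\<^sub>M tuple_space Z k"
  unfolding tuple_space_def[of Z k]
  by (intro measurable_restrict measurable_tuple_component assms)

lemma measurable_restrict_tuple: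
  "k \<le> m \<Longrightarrow> (\<lambda>d. restrict d {1..k}) \<in> tuple_space Z m \<rightarrow>\<^sub>M tuple_space Z k"
  using measurable_tuple_reindex[of k "\<lambda>j. j" m] by auto

lemma measurable_drop_entry:
  fixes Z :: "'z measure"
  assumes "i \<in> {1..n + 1}"
  shows "drop_entry (n + 1) i \<in> tuple_space Z (n + 1) \<rightarrow>\<^sub>M tuple_space Z n"
proof -
  have "drop_entry (n + 1) i = (\<lambda>d :: nat \<Rightarrow> 'z. \<lambda>j\<in>{1..n}. d (if j < i then j else j + 1))"
    by (auto simp: drop_entry_def fun_eq_iff restrict_def)
  moreover have "\<dots> \<in> tuple_space Z (n + 1) \<rightarrow>\<^sub>M tuple_space Z n"
    by (rule measurable_tuple_reindex) auto
  ultimately show ?thesis by (simp only:)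
qed

lemma measurable_loo_score:
  assumes "(\<lambda>(z, \<tau>). c z \<tau>) \<in> borel_measurable (Z \<Otimes>\<^sub>M tuple_space Z n)" "i \<in> {1..n + 1}"
  shows "loo_score c n i \<in> borel_measurable (tuple_space Z (n + 1))"
  unfolding loo_score_def
  using measurable_compose[OF measurable_Pair[OF measurable_tuple_component[OF assms(2)]
      measurable_drop_entry[OF assms(2)]] assms(1)] by simp

text \<open>
  A function symmetric on \<open>n\<close>-tuples depends only on the index set \<open>S\<close> from which the entries are drawn, not on
  its enumeration.
\<close>

lemma symmetric_reindex:
  assumes sym: "\<And>\<tau> \<pi>. \<tau> \<in> space (tuple_space Z n) \<Longrightarrow> \<pi> permutes {1..n} \<Longrightarrow> h (\<tau> \<circ> \<pi>) = h \<tau>"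
    and a: "bij_betw a {1..n} S" and b: "bij_betw b {1..n} S"
    and S: "\<And>j. j \<in> S \<Longrightarrow> d j \<in> space Z"
  shows "h (\<lambda>j\<in>{1..n}. d (a j)) = h (\<lambda>j\<in>{1..n}. d (b j))"
proof -
  define \<rho> where "\<rho> = (\<lambda>j. if j \<in> {1..n} then inv_into {1..n} b (a j) else j)"
  have "bij_betw (inv_into {1..n} b \<circ> a) {1..n} {1..n}"
    using a bij_betw_inv_into[OF b] by (rule bij_betw_trans)
  then have "bij_betw \<rho> {1..n} {1..n}"
    by (rule bij_betw_cong[THEN iffD1, rotated]) (auto simp: \<rho>_def)
  then have perm: "\<rho> permutes {1..n}"
    by (rule bij_imp_permutes) (auto simp: \<rho>_def)
  have "a j \<in> b ` {1..n}" if "j \<in> {1..n}" for j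
    using a b that by (auto simp: bij_betw_def)
  then have b\<rho>: "b (\<rho> j) = a j" if "j \<in> {1..n}" for j
    using that by (simp add: \<rho>_def f_inv_into_f del: atLeastAtMost_iff)
  have "(\<lambda>j\<in>{1..n}. d (a j)) = (\<lambda>j\<in>{1..n}. d (b j)) \<circ> \<rho>"
    using b\<rho> permutes_in_image[OF perm] by (auto simp: fun_eq_iff restrict_def)
  moreover have "(\<lambda>j\<in>{1..n}. d (b j)) \<in> space (tuple_space Z n)"
    using b S by (auto simp: tuple_space_def space_PiM bij_betw_def)
  ultimately show ?thesis using sym perm by simp
qed

lemma loo_score_permute:
  assumes sym: "conformity_score Z n c"
    and d: "d \<in> space (tuple_space Z (n + 1))"
    and i: "i \<in> {1..n + 1}" and \<pi>: "\<pi> permutes {1..n + 1}"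
  shows "loo_score c n i (\<lambda>j\<in>{1..n + 1}. d (\<pi> j)) = loo_score c n (\<pi> i) d"
proof -
  define s where "s = (\<lambda>i j. if j < i then j else j + 1 :: nat)"
  have s: "bij_betw (s i) {1..n} ({1..n + 1} - {i})" if "i \<in> {1..n + 1}" for i
    unfolding bij_betw_def
  proof
    show "inj_on (s i) {1..n}" by (auto simp: s_def inj_on_def split: if_splits)
    show "s i ` {1..n} = {1..n + 1} - {i}"
    proof (intro equalityI subsetI)
      fix j assume "j \<in> {1..n + 1} - {i}"
      then have "j = s i (if j < i then j else j - 1)" "(if j < i then j else j - 1) \<in> {1..n}"
        using that by (auto simp: s_def)
      then show "j \<in> s i ` {1..n}" by blast
    qed (use that in \<open>auto simp: s_def split: if_splits\<close>)
  qed
  have \<pi>i: "\<pi> i \<in> {1..n + 1}" using permutes_in_image[OF \<pi>] i by blast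
  \<comment> \<open>On either side, the training entries enumerate the entries of \<open>d\<close> other than the \<open>\<pi> i\<close>-th.\<close>
  have "bij_betw \<pi> ({1..n + 1} - {i}) ({1..n + 1} - {\<pi> i})"
    using bij_betw_DiffI[OF permutes_imp_bij[OF \<pi>], of "{i}" "{\<pi> i}"] i \<pi>i by auto
  with s[OF i] have "bij_betw (\<pi> \<circ> s i) {1..n} ({1..n + 1} - {\<pi> i})"
    by (rule bij_betw_trans)
  moreover have mem: "d j \<in> space Z" if "j \<in> {1..n + 1}" for j
    using d that by (auto simp: tuple_space_def space_PiM)
  ultimately have "c (d (\<pi> i)) (\<lambda>j\<in>{1..n}. d ((\<pi> \<circ> s i) j)) = c (d (\<pi> i)) (\<lambda>j\<in>{1..n}. d (s (\<pi> i) j))"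
    using s[OF \<pi>i] sym mem[OF \<pi>i]
    by (intro symmetric_reindex[where Z = Z and S = "{1..n + 1} - {\<pi> i}"]) (auto simp: conformity_score_def simp del: o_apply)
  moreover have "drop_entry (n + 1) i (\<lambda>j\<in>{1..n + 1}. d (\<pi> j)) = (\<lambda>j\<in>{1..n}. d ((\<pi> \<circ> s i) j))"
    "drop_entry (n + 1) (\<pi> i) d = (\<lambda>j\<in>{1..n}. d (s (\<pi> i) j))"
    by (auto simp: drop_entry_def s_def fun_eq_iff restrict_def)
  ultimately show ?thesis using i by (simp add: loo_score_def)
qed

section \<open>Integration over samples of independent observations\<close>

context prob_space
begin

lemma prob_space_tuple: "prob_space (tuple_space M m)"
  unfolding tuple_space_def by (rule prob_space_PiM) unfold_locales

lemma integral_tuple_permute: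
  fixes u :: "(nat \<Rightarrow> 'a) \<Rightarrow> real"
  assumes "\<pi> permutes {1..m}" and u: "u \<in> borel_measurable (tuple_space M m)"
  shows "(\<integral>d. u (\<lambda>j\<in>{1..m}. d (\<pi> j)) \<partial>tuple_space M m) = (\<integral>d. u d \<partial>tuple_space M m)"
proof -
  have \<pi>: "\<And>j. j \<in> {1..m} \<Longrightarrow> \<pi> j \<in> {1..m}" "inj_on \<pi> {1..m}"
    using permutes_in_image[OF assms(1)] permutes_inj_on[OF assms(1)] by blast+
  have "distr (tuple_space M m) (tuple_space M m) (\<lambda>d. \<lambda>j\<in>{1..m}. d (\<pi> j)) = tuple_space M m"
    unfolding tuple_space_def
    by (rule distr_PiM_reindex) (use \<pi> in \<open>auto simp: prob_space_axioms\<close>)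
  then show ?thesis
    using integral_distr[OF measurable_tuple_reindex[of m \<pi> m] u] \<pi> by simp
qed

lemma integral_tuple_Suc:
  fixes u :: "(nat \<Rightarrow> 'a) \<Rightarrow> real"
  assumes u: "u \<in> borel_measurable (tuple_space M (n + 1))" and B: "\<And>d. \<bar>u d\<bar> \<le> B"
  shows "(\<integral>d. u d \<partial>tuple_space M (n + 1)) = (\<integral>\<tau>. \<integral>z. u (\<tau>(n + 1 := z)) \<partial>M \<partial>tuple_space M n)"
proof -
  interpret product_sigma_finite "\<lambda>_::nat. M" by unfold_locales
  interpret Q: prob_space "tuple_space M (n + 1)" by (rule prob_space_tuple)
  have "integrable (tuple_space M (n + 1)) u"
    by (rule Q.integrable_const_bound[where B = B]) (use u B in auto)
  moreover have "{1..n + 1} = insert (n + 1) {1..n}" by auto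
  ultimately show ?thesis
    unfolding tuple_space_def by (simp del: Suc_eq_plus1 add: product_integral_insert)
qed

end

lemma (in prob_space) expectation_mult_perturb:
  fixes a b a' b' :: "'a \<Rightarrow> real"
  assumes m: "a \<in> borel_measurable M" "b \<in> borel_measurable M"
      "a' \<in> borel_measurable M" "b' \<in> borel_measurable M"
    and bnd: "\<And>x. \<bar>a x\<bar> \<le> 1" "\<And>x. \<bar>b x\<bar> \<le> 1" "\<And>x. \<bar>a' x\<bar> \<le> 1" "\<And>x. \<bar>b' x\<bar> \<le> 1"
  shows "\<bar>expectation (\<lambda>x. a x * b x) - expectation (\<lambda>x. a' x * b' x)\<bar>
    \<le> expectation (\<lambda>x. \<bar>a x - a' x\<bar>) + expectation (\<lambda>x. \<bar>b x - b' x\<bar>)"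
proof -
  have prod: "\<bar>u x * v x\<bar> \<le> 1" if "\<And>x. \<bar>u x\<bar> \<le> 1" "\<And>x. \<bar>v x\<bar> \<le> 1" for u v :: "'a \<Rightarrow> real" and x
    unfolding abs_mult using that by (intro mult_le_one) auto
  have int2: "integrable M (\<lambda>x. \<bar>u x - v x\<bar>)"
    if "u \<in> borel_measurable M" "v \<in> borel_measurable M" "\<And>x. \<bar>u x\<bar> \<le> 1" "\<And>x. \<bar>v x\<bar> \<le> 1"
    for u v :: "'a \<Rightarrow> real"
  proof (rule integrable_const_bound[where B = 2])
    have "\<bar>u x - v x\<bar> \<le> 2" for x using that(3,4)[of x] by linarith
    then show "AE x in M. norm \<bar>u x - v x\<bar> \<le> 2" by simp
  qed (use that in measurable)
  have i: "integrable M (\<lambda>x. a x * b x)" "integrable M (\<lambda>x. a' x * b' x)"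
    by (rule integrable_const_bound[where B = 1]; use m prod bnd in simp)+
  have "\<bar>expectation (\<lambda>x. a x * b x) - expectation (\<lambda>x. a' x * b' x)\<bar>
      = \<bar>expectation (\<lambda>x. a x * b x - a' x * b' x)\<bar>"
    using i by simp
  also have "\<dots> \<le> expectation (\<lambda>x. \<bar>a x * b x - a' x * b' x\<bar>)"
    by (rule integral_abs_bound)
  also have "\<dots> \<le> expectation (\<lambda>x. \<bar>a x - a' x\<bar> + \<bar>b x - b' x\<bar>)"
  proof (rule integral_mono)
    fix x
    have "a x * b x - a' x * b' x = (a x - a' x) * b x + a' x * (b x - b' x)"
      by (simp add: algebra_simps)
    also have "\<bar>\<dots>\<bar> \<le> \<bar>a x - a' x\<bar> * \<bar>b x\<bar> + \<bar>a' x\<bar> * \<bar>b x - b' x\<bar>"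
      by (metis abs_mult abs_triangle_ineq)
    also have "\<dots> \<le> \<bar>a x - a' x\<bar> + \<bar>b x - b' x\<bar>"
      using bnd by (intro add_mono mult_left_le mult_left_le_one_le) auto
    finally show "\<bar>a x * b x - a' x * b' x\<bar> \<le> \<bar>a x - a' x\<bar> + \<bar>b x - b' x\<bar>" .
  qed (use i int2 m bnd in auto)
  also have "\<dots> = expectation (\<lambda>x. \<bar>a x - a' x\<bar>) + expectation (\<lambda>x. \<bar>b x - b' x\<bar>)"
    using int2 m bnd by simp
  finally show ?thesis .
qed

context prob_space
begin

lemma measurable_integral_first:
  fixes v :: "'a \<Rightarrow> 'b \<Rightarrow> real"
  assumes v: "(\<lambda>(z, \<tau>). v z \<tau>) \<in> borel_measurable (M \<Otimes>\<^sub>M N)"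
  shows "(\<lambda>\<tau>. \<integral>z. v z \<tau> \<partial>M) \<in> borel_measurable N"
  using measurable_compose[OF measurable_pair_swap' v]
  by (intro borel_measurable_lebesgue_integral) (simp add: case_prod_unfold)

lemma expectation_le_1:
  fixes v :: "'a \<Rightarrow> real"
  assumes "\<And>x. 0 \<le> v x" "\<And>x. v x \<le> 1"
  shows "0 \<le> expectation v" "expectation v \<le> 1"
proof -
  show "0 \<le> expectation v" using assms by simp
  show "expectation v \<le> 1"
  proof (cases "integrable M v")
    case True
    then show ?thesis using integral_mono[of M v "\<lambda>_. 1"] assms by (simp add: prob_space)
  qed (simp add: not_integrable_integral_eq)
qed

text \<open>
  Conditioning on the first \<open>n\<close> of \<open>n + 1\<close> independent observations: a function of the last one may be replaced by
  its mean over a fresh observation.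
\<close>

lemma integral_last_entry:
  fixes u :: "(nat \<Rightarrow> 'a) \<Rightarrow> real" and v :: "'a \<Rightarrow> (nat \<Rightarrow> 'a) \<Rightarrow> real"
  assumes u: "u \<in> borel_measurable (tuple_space M n)"
    and v: "(\<lambda>(z, \<tau>). v z \<tau>) \<in> borel_measurable (M \<Otimes>\<^sub>M tuple_space M n)"
    and bnd: "\<And>d. \<bar>u d\<bar> \<le> 1" "\<And>z \<tau>. 0 \<le> v z \<tau>" "\<And>z \<tau>. v z \<tau> \<le> 1"
  shows "(\<integral>d. u (restrict d {1..n}) * v (d (n + 1)) (restrict d {1..n}) \<partial>tuple_space M (n + 1))
    = (\<integral>d. u (restrict d {1..n}) * (\<integral>z. v z (restrict d {1..n}) \<partial>M) \<partial>tuple_space M (n + 1))"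
    (is "?L = ?R")
proof -
  note r = measurable_restrict_tuple[of n "n + 1" M, simplified]
  note e = measurable_tuple_component[of "n + 1" "n + 1" M, simplified]
  have mv: "(\<lambda>d. v (d (Suc n)) (restrict d {Suc 0..n})) \<in> borel_measurable (tuple_space M (Suc n))"
    using measurable_compose[OF measurable_Pair[OF e r] v] by simp
  have mu: "(\<lambda>d. u (restrict d {Suc 0..n})) \<in> borel_measurable (tuple_space M (Suc n))"
    using measurable_compose[OF r u] .
  have mi: "(\<lambda>d. \<integral>z. v z (restrict d {Suc 0..n}) \<partial>M) \<in> borel_measurable (tuple_space M (Suc n))"
    using measurable_compose[OF r measurable_integral_first[OF v]] .
  have rs: "restrict (\<tau>(Suc n := z)) {Suc 0..n} = \<tau>" if "\<tau> \<in> space (tuple_space M n)" for \<tau> z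
    using that by (auto simp: tuple_space_def space_PiM PiE_def extensional_def fun_eq_iff restrict_def)
  have rs': "restrict \<tau> {Suc 0..n} = \<tau>" if "\<tau> \<in> space (tuple_space M n)" for \<tau>
    using that by (auto simp: tuple_space_def space_PiM PiE_def extensional_restrict)
  have b: "\<bar>u d * w\<bar> \<le> 1" if "0 \<le> w" "w \<le> 1" for d w
    unfolding abs_mult using bnd(1)[of d] that by (intro mult_le_one) auto
  have "?L = (\<integral>\<tau>. \<integral>z. u \<tau> * v z \<tau> \<partial>M \<partial>tuple_space M n)"
    using integral_tuple_Suc[of "\<lambda>d. u (restrict d {1..n}) * v (d (n + 1)) (restrict d {1..n})" n 1]
      mv mu b bnd
    by (simp add: rs rs' cong: Bochner_Integration.integral_cong)
  also have "\<dots> = (\<integral>\<tau>. \<integral>z. u \<tau> * (\<integral>z. v z \<tau> \<partial>M) \<partial>M \<partial>tuple_space M n)"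
    by (simp add: prob_space)
  also have "\<dots> = ?R"
    using integral_tuple_Suc[of "\<lambda>d. u (restrict d {1..n}) * (\<integral>z. v z (restrict d {1..n}) \<partial>M)" n 1]
      mi mu b expectation_le_1 bnd
    by (simp add: rs rs' cong: Bochner_Integration.integral_cong)
  finally show ?thesis .
qed

end

section \<open>Leave-one-out averages against conditional means\<close>

text \<open>
  Two scores with values in \<open>[0, 1]\<close>: a symmetric score \<open>f\<close> for training samples of size \<open>n\<close>, and a score \<open>g\<close> for
  training samples of size \<open>n - 1\<close> that is to approximate \<open>f\<close>. Here \<open>M\<close> is the distribution of a single observation.
\<close>

locale score_pair = prob_space M for M :: "obs measure" +
  fixes n :: nat and f g :: score
  assumes n: "1 \<le> n"
    and f: "conformity_score M n f"
    and g: "(\<lambda>(z, \<tau>). g z \<tau>) \<in> borel_measurable (M \<Otimes>\<^sub>M tuple_space M (n - 1))"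
    and f_bounds: "\<And>z \<tau>. 0 \<le> f z \<tau>" "\<And>z \<tau>. f z \<tau> \<le> 1"
    and g_bounds: "\<And>z \<tau>. 0 \<le> g z \<tau>" "\<And>z \<tau>. g z \<tau> \<le> 1"
begin

abbreviation Q :: "(nat \<Rightarrow> obs) measure" where
  "Q \<equiv> tuple_space M (n + 1)"

sublocale Q: prob_space Q
  by (rule prob_space_tuple)

text \<open>
  The approximate score of the \<open>i\<close>-th observation, always trained on the first \<open>n - 1\<close> observations; it is of interest
  for \<open>i = n\<close> and \<open>i = n + 1\<close>.
\<close>

definition score' :: "nat \<Rightarrow> (nat \<Rightarrow> obs) \<Rightarrow> real" where
  "score' i d = g (d i) (restrict d {1..n - 1})"

text \<open>
  The mean effect on the score of the new observation of dropping the last training observation.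
\<close>

definition instability :: real where
  "instability = Q.expectation (\<lambda>d. \<bar>loo_score f n (n + 1) d - score' (n + 1) d\<bar>)"

lemma f_measurable: "(\<lambda>(z, \<tau>). f z \<tau>) \<in> borel_measurable (M \<Otimes>\<^sub>M tuple_space M n)"
  using f by (simp add: conformity_score_def)

lemma loo_measurable: "i \<in> {1..n + 1} \<Longrightarrow> loo_score f n i \<in> borel_measurable Q"
  by (rule measurable_loo_score[OF f_measurable])

lemma score'_measurable:
  assumes "i \<in> {1..n + 1}" shows "score' i \<in> borel_measurable Q"
  unfolding score'_def
  using measurable_compose[OF measurable_Pair[OF measurable_tuple_component[OF assms]
      measurable_restrict_tuple[of "n - 1" "n + 1"]] g] by simp

lemma train_mean_measurable: "train_mean M f n \<in> borel_measurable Q"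
  unfolding train_mean_def
  by (rule measurable_compose[OF measurable_restrict_tuple measurable_integral_first[OF f_measurable]]) simp

lemma train_mean'_measurable: "train_mean M g (n - 1) \<in> borel_measurable Q"
  unfolding train_mean_def
  by (rule measurable_compose[OF measurable_restrict_tuple measurable_integral_first[OF g]]) simp

lemma loo_mean_measurable: "loo_mean f n \<in> borel_measurable Q"
  unfolding loo_mean_def using loo_measurable by (intro borel_measurable_divide borel_measurable_sum) auto

lemma loo_bounds: "0 \<le> loo_score f n i d" "loo_score f n i d \<le> 1"
  by (simp_all add: loo_score_def f_bounds)

lemma score'_bounds: "0 \<le> score' i d" "score' i d \<le> 1"
  by (simp_all add: score'_def g_bounds)

lemma train_mean_bounds: "0 \<le> train_mean M f n d" "train_mean M f n d \<le> 1"
  by (simp_all add: train_mean_def f_bounds expectation_le_1)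

lemma train_mean'_bounds: "0 \<le> train_mean M g (n - 1) d" "train_mean M g (n - 1) d \<le> 1"
  by (simp_all add: train_mean_def g_bounds expectation_le_1)

lemma loo_mean_bounds: "0 \<le> loo_mean f n d" "loo_mean f n d \<le> 1"
proof -
  show "0 \<le> loo_mean f n d" unfolding loo_mean_def by (intro divide_nonneg_nonneg sum_nonneg loo_bounds) simp
  have "(\<Sum>i\<in>{1..n + 1}. loo_score f n i d) \<le> (\<Sum>i\<in>{1..n + 1}. 1)"
    by (intro sum_mono loo_bounds)
  then show "loo_mean f n d \<le> 1" by (simp add: loo_mean_def)
qed

lemmas bounds = loo_bounds score'_bounds train_mean_bounds train_mean'_bounds loo_mean_bounds
lemmas meas = loo_measurable score'_measurable train_mean_measurable train_mean'_measurable loo_mean_measurable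

lemma integrable_unit:
  assumes "u \<in> borel_measurable Q" "v \<in> borel_measurable Q"
    "\<And>d. 0 \<le> u d" "\<And>d. u d \<le> 1" "\<And>d. 0 \<le> v d" "\<And>d. v d \<le> (1::real)"
  shows "integrable Q (\<lambda>d. u d * v d)"
  by (rule Q.integrable_const_bound[where B = 1]) (use assms in \<open>auto simp: mult_le_one\<close>)

lemma expectation_permute:
  fixes u v :: "(nat \<Rightarrow> obs) \<Rightarrow> real"
  assumes "\<pi> permutes {1..n + 1}" "u \<in> borel_measurable Q"
    and "\<And>d. d \<in> space Q \<Longrightarrow> u (\<lambda>j\<in>{1..n + 1}. d (\<pi> j)) = v d"
  shows "Q.expectation v = Q.expectation u"
  unfolding integral_tuple_permute[OF assms(1,2), symmetric]
  using assms(3) by (simp cong: Bochner_Integration.integral_cong)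

lemma loo_permute:
  assumes "d \<in> space Q" "i \<in> {1..n + 1}" "\<pi> permutes {1..n + 1}"
  shows "loo_score f n i (\<lambda>j\<in>{1..n + 1}. d (\<pi> j)) = loo_score f n (\<pi> i) d"
  by (rule loo_score_permute[OF f assms])

lemma loo_pair:
  assumes i: "i \<in> {1..n + 1}" and j: "j \<in> {1..n + 1}" and ij: "i \<noteq> j"
  shows "Q.expectation (\<lambda>d. loo_score f n i d * loo_score f n j d)
    = Q.expectation (\<lambda>d. loo_score f n n d * loo_score f n (n + 1) d)"
proof -
  define \<pi>1 where "\<pi>1 = Transposition.transpose n i"
  define \<pi> where "\<pi> = Transposition.transpose (\<pi>1 (n + 1)) j \<circ> \<pi>1"
  have p1: "\<pi>1 permutes {1..n + 1}" unfolding \<pi>1_def using i n by (intro permutes_swap_id) auto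
  have p: "\<pi> permutes {1..n + 1}"
    unfolding \<pi>_def using permutes_in_image[OF p1, of "n + 1"] j
    by (intro permutes_compose[OF p1] permutes_swap_id) auto
  have v: "\<pi> n = i" "\<pi> (n + 1) = j"
    using ij by (auto simp: \<pi>_def \<pi>1_def Transposition.transpose_def)
  show ?thesis
    by (rule expectation_permute[OF p]) (use n meas v in \<open>simp_all add: loo_permute[OF _ _ p, simplified]\<close>)
qed

lemma loo_train_mean:
  assumes i: "i \<in> {1..n}"
  shows "Q.expectation (\<lambda>d. loo_score f n i d * train_mean M f n d)
    = Q.expectation (\<lambda>d. loo_score f n n d * train_mean M f n d)"
proof -
  define \<pi> where "\<pi> = Transposition.transpose n i"
  have p: "\<pi> permutes {1..n}" unfolding \<pi>_def using i n by (intro permutes_swap_id) auto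
  then have p': "\<pi> permutes {1..n + 1}" by (rule permutes_subset) auto
  have v: "\<pi> n = i" by (simp add: \<pi>_def)
  have cm: "train_mean M f n (\<lambda>j\<in>{1..n + 1}. d (\<pi> j)) = train_mean M f n d" if d: "d \<in> space Q" for d
    unfolding train_mean_def
  proof (rule Bochner_Integration.integral_cong[OF refl])
    fix z assume z: "z \<in> space M"
    have "restrict (\<lambda>j\<in>{1..n + 1}. d (\<pi> j)) {1..n} = restrict d {1..n} \<circ> \<pi>"
      using permutes_in_image[OF p] by (auto simp: restrict_def fun_eq_iff)
    moreover have "restrict d {1..n} \<in> space (tuple_space M n)"
      using measurable_space[OF measurable_restrict_tuple[of n "n + 1" M] d] by simp
    ultimately show "f z (restrict (\<lambda>j\<in>{1..n + 1}. d (\<pi> j)) {1..n}) = f z (restrict d {1..n})"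
      using f z p by (simp add: conformity_score_def)
  qed
  show ?thesis
    by (rule expectation_permute[OF p'])
      (use n meas v cm in \<open>simp_all add: loo_permute[OF _ _ p', simplified]\<close>)
qed

lemma permutes_last_two: "Transposition.transpose n (n + 1) permutes {1..n + 1}"
  using n by (intro permutes_swap_id) auto

lemma swap_last:
  defines "\<pi> \<equiv> Transposition.transpose n (n + 1)"
  assumes d: "d \<in> space Q"
  shows "loo_score f n (n + 1) (\<lambda>j\<in>{1..n + 1}. d (\<pi> j)) = loo_score f n n d"
    and "score' (n + 1) (\<lambda>j\<in>{1..n + 1}. d (\<pi> j)) = score' n d"
    and "train_mean M g (n - 1) (\<lambda>j\<in>{1..n + 1}. d (\<pi> j)) = train_mean M g (n - 1) d"
proof -
  have p: "\<pi> permutes {1..n + 1}" unfolding \<pi>_def by (rule permutes_last_two)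
  show "loo_score f n (n + 1) (\<lambda>j\<in>{1..n + 1}. d (\<pi> j)) = loo_score f n n d"
    using loo_permute[OF d _ p, of "n + 1"] by (simp add: \<pi>_def)
  have r: "restrict (\<lambda>j\<in>{1..n + 1}. d (\<pi> j)) {1..n - 1} = restrict d {1..n - 1}"
    by (auto simp: \<pi>_def restrict_def fun_eq_iff Transposition.transpose_def)
  show "score' (n + 1) (\<lambda>j\<in>{1..n + 1}. d (\<pi> j)) = score' n d"
    unfolding score'_def r by (simp add: \<pi>_def)
  show "train_mean M g (n - 1) (\<lambda>j\<in>{1..n + 1}. d (\<pi> j)) = train_mean M g (n - 1) d"
    unfolding train_mean_def r ..
qed

text \<open>
  Exchanging the last two observations turns the \<open>(n + 1)\<close>-st leave-one-out score into the \<open>n\<close>-th and leaves the first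
  \<open>n - 1\<close> observations unchanged.
\<close>

lemma instability_swap: "Q.expectation (\<lambda>d. \<bar>loo_score f n n d - score' n d\<bar>) = instability"
  unfolding instability_def
  by (rule expectation_permute[OF permutes_last_two]) (use meas in \<open>simp_all add: swap_last[simplified]\<close>)

lemma g_lift: "(\<lambda>(z, \<tau>). g z (restrict \<tau> {1..n - 1})) \<in> borel_measurable (M \<Otimes>\<^sub>M tuple_space M n)"
proof -
  have "(\<lambda>x. (fst x, restrict (snd x) {1..n - 1})) \<in> M \<Otimes>\<^sub>M tuple_space M n \<rightarrow>\<^sub>M M \<Otimes>\<^sub>M tuple_space M (n - 1)"
    by (intro measurable_Pair measurable_fst measurable_compose[OF measurable_snd measurable_restrict_tuple]) simp
  from measurable_compose[OF this g] show ?thesis by (simp add: case_prod_unfold)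
qed

lemma restrict_lower: "restrict (restrict d {1..n}) {1..n - 1} = restrict d {1..n - 1}"
  by (auto simp: restrict_def fun_eq_iff)

lemma loo_last: "loo_score f n (n + 1) d = f (d (n + 1)) (restrict d {1..n})"
  unfolding loo_score_def drop_last_entry by simp

lemma train_mean_sq:
  "Q.expectation (\<lambda>d. train_mean M f n d * loo_score f n (n + 1) d) = Q.expectation (\<lambda>d. train_mean M f n d * train_mean M f n d)"
proof -
  have [simp]: "train_mean M f n (restrict d {Suc 0..n}) = train_mean M f n d" for d
    by (simp add: train_mean_def Int_absorb)
  have "train_mean M f n \<in> borel_measurable (tuple_space M n)"
    unfolding train_mean_def
    by (rule measurable_compose[OF measurable_restrict_tuple measurable_integral_first[OF f_measurable]]) simp
  then show ?thesis
    using integral_last_entry[of "train_mean M f n" n f] f_measurable bounds f_bounds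
    by (simp add: loo_last[simplified] train_mean_def[symmetric, simplified] abs_of_nonneg)
qed

lemma score'_last:
  assumes u: "u \<in> borel_measurable (tuple_space M n)" "\<And>d. \<bar>u d\<bar> \<le> 1"
  shows "Q.expectation (\<lambda>d. u (restrict d {1..n}) * score' (n + 1) d)
    = Q.expectation (\<lambda>d. u (restrict d {1..n}) * train_mean M g (n - 1) d)"
  using integral_last_entry[OF u(1) g_lift u(2)] g_bounds
  unfolding restrict_lower by (simp add: score'_def train_mean_def)

lemma score'_pair:
  "Q.expectation (\<lambda>d. score' n d * score' (n + 1) d) = Q.expectation (\<lambda>d. score' n d * train_mean M g (n - 1) d)"
proof -
  have "score' n \<in> borel_measurable (tuple_space M n)"
    unfolding score'_def
    using measurable_compose[OF measurable_Pair[OF measurable_tuple_component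
      measurable_restrict_tuple[of "n - 1" n]] g] n by simp
  moreover have "score' n (restrict d {1..n}) = score' n d" for d
    using n unfolding score'_def restrict_lower by simp
  ultimately show ?thesis
    using score'_last[of "score' n"] bounds by (simp add: abs_of_nonneg)
qed

lemma train_mean'_score':
  "Q.expectation (\<lambda>d. train_mean M g (n - 1) d * score' (n + 1) d) = Q.expectation (\<lambda>d. score' n d * train_mean M g (n - 1) d)"
  by (rule expectation_permute[OF permutes_last_two, symmetric])
    (use meas in \<open>simp_all add: swap_last[simplified] mult.commute\<close>)

text \<open>
  The conditional mean is at most as unstable as the score itself.
\<close>

lemma train_mean_diff: "Q.expectation (\<lambda>d. \<bar>train_mean M f n d - train_mean M g (n - 1) d\<bar>) \<le> instability"
proof -
  define v where "v = (\<lambda>z \<tau>. \<bar>f z \<tau> - g z (restrict \<tau> {1..n - 1})\<bar>)"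
  have v01: "0 \<le> v z \<tau>" "v z \<tau> \<le> 1" for z \<tau>
    using f_bounds[of z \<tau>] g_bounds[of z "restrict \<tau> {1..n - 1}"] unfolding v_def by linarith+
  have v: "(\<lambda>(z, \<tau>). v z \<tau>) \<in> borel_measurable (M \<Otimes>\<^sub>M tuple_space M n)"
    using f_measurable g_lift unfolding v_def case_prod_unfold by measurable
  have vm: "(\<lambda>d. \<integral>z. v z (restrict d {1..n}) \<partial>M) \<in> borel_measurable Q"
    by (rule measurable_compose[OF measurable_restrict_tuple measurable_integral_first[OF v]]) simp
  have "Q.expectation (\<lambda>d. \<bar>train_mean M f n d - train_mean M g (n - 1) d\<bar>) \<le> Q.expectation (\<lambda>d. \<integral>z. v z (restrict d {1..n}) \<partial>M)"
  proof (rule integral_mono)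
    have "\<bar>train_mean M f n d - train_mean M g (n - 1) d\<bar> \<le> 1" for d
      using train_mean_bounds[of d] train_mean'_bounds[of d] by linarith
    then show "integrable Q (\<lambda>d. \<bar>train_mean M f n d - train_mean M g (n - 1) d\<bar>)"
      using meas by (intro Q.integrable_const_bound[where B = 1] AE_I2) auto
    show "integrable Q (\<lambda>d. \<integral>z. v z (restrict d {1..n}) \<partial>M)"
      using vm v01 expectation_le_1 by (intro Q.integrable_const_bound[where B = 1] AE_I2) auto
    fix d assume d: "d \<in> space Q"
    have i: "integrable M (\<lambda>z. f z (restrict d {1..n}))" "integrable M (\<lambda>z. g z (restrict d {1..n - 1}))"
    proof -
      have r: "restrict d {1..k} \<in> space (tuple_space M k)" if "k \<le> n + 1" for k
        using measurable_space[OF measurable_restrict_tuple[of _ "n + 1" M] d] that by auto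
      have "(\<lambda>z. f z (restrict d {1..n})) \<in> borel_measurable M"
        using measurable_compose[OF measurable_Pair2'[OF r[of n]] f_measurable] by simp
      moreover have "(\<lambda>z. g z (restrict d {1..n - 1})) \<in> borel_measurable M"
        using measurable_compose[OF measurable_Pair2'[OF r[of "n - 1"]] g] by simp
      ultimately show "integrable M (\<lambda>z. f z (restrict d {1..n}))" "integrable M (\<lambda>z. g z (restrict d {1..n - 1}))"
        using f_bounds g_bounds by (auto intro!: integrable_const_bound[where B = 1] AE_I2)
    qed
    have "train_mean M f n d - train_mean M g (n - 1) d = (\<integral>z. f z (restrict d {1..n}) - g z (restrict d {1..n - 1}) \<partial>M)"
      unfolding train_mean_def using i by simp
    also have "\<bar>\<dots>\<bar> \<le> (\<integral>z. v z (restrict d {1..n}) \<partial>M)"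
      unfolding v_def restrict_lower by (rule integral_abs_bound)
    finally show "\<bar>train_mean M f n d - train_mean M g (n - 1) d\<bar> \<le> (\<integral>z. v z (restrict d {1..n}) \<partial>M)" .
  qed
  also have "\<dots> = Q.expectation (\<lambda>d. v (d (n + 1)) (restrict d {1..n}))"
    using integral_last_entry[of "\<lambda>_. 1" n v] v v01 by simp
  also have "\<dots> = instability"
    unfolding instability_def v_def restrict_lower loo_last score'_def ..
  finally show ?thesis .
qed

lemma mult_perturb:
  assumes "a \<in> borel_measurable Q" "b \<in> borel_measurable Q"
      "a' \<in> borel_measurable Q" "b' \<in> borel_measurable Q"
    and "\<And>x. 0 \<le> a x" "\<And>x. a x \<le> 1" "\<And>x. 0 \<le> b x" "\<And>x. b x \<le> 1"
      "\<And>x. 0 \<le> a' x" "\<And>x. a' x \<le> 1" "\<And>x. 0 \<le> b' x" "\<And>x. b' x \<le> (1::real)"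
    and "Q.expectation (\<lambda>x. \<bar>a x - a' x\<bar>) \<le> instability" "Q.expectation (\<lambda>x. \<bar>b x - b' x\<bar>) \<le> instability"
  shows "\<bar>Q.expectation (\<lambda>x. a x * b x) - Q.expectation (\<lambda>x. a' x * b' x)\<bar> \<le> 2 * instability"
  using Q.expectation_mult_perturb[of a b a' b'] assms by simp

text \<open>
  The expansion of the square produces the second moments of leave-one-out mean and conditional mean.
  Each is, up to the instability and to the \<open>1 / (n + 1)\<close> share of exceptional terms, the expectation of the
  product of \<open>score' n\<close> with its conditional mean.
\<close>

lemma loo_mean_L2:
  "Q.expectation (\<lambda>d. (loo_mean f n d - train_mean M f n d)\<^sup>2) \<le> 2 / real (n + 1) + 8 * instability"
proof -
  \<comment> \<open>The common approximate value of the three second moments.\<close>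
  define q where "q = Q.expectation (\<lambda>d. score' n d * train_mean M g (n - 1) d)"
  define N where "N = real (n + 1)"
  have N: "N > 0" "real n = N - 1" by (simp_all add: N_def)
  let ?f = "loo_score f n"
  have inst: "Q.expectation (\<lambda>d. \<bar>?f (n + 1) d - score' (n + 1) d\<bar>) \<le> instability"
    by (simp add: instability_def)
  have ff: "\<bar>Q.expectation (\<lambda>d. ?f n d * ?f (n + 1) d) - q\<bar> \<le> 2 * instability"
    unfolding q_def score'_pair[symmetric]
    using inst instability_swap n by (intro mult_perturb meas bounds) auto
  have fB: "\<bar>Q.expectation (\<lambda>d. ?f n d * train_mean M f n d) - q\<bar> \<le> 2 * instability"
    unfolding q_def using train_mean_diff instability_swap n by (intro mult_perturb meas bounds) auto
  have BB: "\<bar>Q.expectation (\<lambda>d. train_mean M f n d * train_mean M f n d) - q\<bar> \<le> 2 * instability"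
    unfolding q_def train_mean_sq[symmetric] train_mean'_score'[symmetric]
    using train_mean_diff inst n by (intro mult_perturb meas bounds) auto
  have q1: "q \<le> 1" unfolding q_def by (intro Q.expectation_le_1 mult_nonneg_nonneg mult_le_one bounds)
  have i0: "0 \<le> instability" unfolding instability_def by simp
  define I where "I = {1..n + 1}"
  have I: "finite I" "card I = n + 1" "I = insert (n + 1) {1..n}" by (auto simp: I_def)
  have mean: "loo_mean f n d = (\<Sum>i\<in>I. ?f i d) / N" for d by (simp only: loo_mean_def I_def N_def)
  have iff: "integrable Q (\<lambda>d. ?f i d * ?f j d)" if "i \<in> I" "j \<in> I" for i j
    using that unfolding I_def by (intro integrable_unit meas bounds)
  have ifB: "integrable Q (\<lambda>d. ?f i d * train_mean M f n d)" if "i \<in> I" for i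
    using that unfolding I_def by (intro integrable_unit meas bounds)
  have AA: "Q.expectation (\<lambda>d. loo_mean f n d * loo_mean f n d) \<le> 1 / N + (N - 1) / N * (q + 2 * instability)"
  proof -
    have "Q.expectation (\<lambda>d. loo_mean f n d * loo_mean f n d)
        = Q.expectation (\<lambda>d. (\<Sum>i\<in>I. \<Sum>j\<in>I. ?f i d * ?f j d) / (N * N))"
      by (simp add: mean sum_product)
    also have "\<dots> = (\<Sum>i\<in>I. \<Sum>j\<in>I. Q.expectation (\<lambda>d. ?f i d * ?f j d)) / (N * N)"
      using iff by (subst integral_divide_zero) (simp add: Bochner_Integration.integral_sum)
    also have "\<dots> \<le> (\<Sum>i\<in>I. \<Sum>j\<in>I. if j = i then 1 else q + 2 * instability) / (N * N)"
    proof (intro divide_right_mono sum_mono)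
      fix i j assume ij: "i \<in> I" "j \<in> I"
      show "Q.expectation (\<lambda>d. ?f i d * ?f j d) \<le> (if j = i then 1 else q + 2 * instability)"
      proof (cases "i = j")
        case True
        then show ?thesis using Q.expectation_le_1(2)[of "\<lambda>d. ?f i d * ?f j d"] by (simp add: bounds mult_le_one)
      next
        case False
        then show ?thesis using ff loo_pair[OF ij[unfolded I_def] False] by simp
      qed
    qed (use N in simp)
    also have "\<dots> = (\<Sum>i\<in>I. 1 + (N - 1) * (q + 2 * instability)) / (N * N)"
    proof (intro arg_cong2[where f = "(/)"] sum.cong refl)
      fix i assume i: "i \<in> I"
      have "card (I - {i}) = n" using i I by simp
      then show "(\<Sum>j\<in>I. if j = i then 1 else q + 2 * instability) = 1 + (N - 1) * (q + 2 * instability)"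
        using N(2) I(1) by (subst sum.remove[OF _ i]) simp_all
    qed
    also have "\<dots> = 1 / N + (N - 1) / N * (q + 2 * instability)"
    proof -
      have "real (card I) = N" by (simp add: I N_def)
      then show ?thesis using N(1) by (simp add: field_simps)
    qed
    finally show ?thesis .
  qed
  have AB: "Q.expectation (\<lambda>d. loo_mean f n d * train_mean M f n d) \<ge> (N - 1) / N * (q - 2 * instability)"
  proof -
    have "(N - 1) / N * (q - 2 * instability) = (\<Sum>i\<in>{1..n}. q - 2 * instability) / N"
      using N by simp
    also have "\<dots> \<le> (\<Sum>i\<in>{1..n}. Q.expectation (\<lambda>d. ?f i d * train_mean M f n d)) / N"
    proof (intro divide_right_mono sum_mono)
      show "q - 2 * instability \<le> Q.expectation (\<lambda>d. ?f i d * train_mean M f n d)" if "i \<in> {1..n}" for i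
        unfolding loo_train_mean[OF that] using fB by linarith
    qed (use N in simp)
    also have "\<dots> \<le> (\<Sum>i\<in>I. Q.expectation (\<lambda>d. ?f i d * train_mean M f n d)) / N"
      using N I by (intro divide_right_mono sum_mono2) (auto simp: bounds)
    also have "\<dots> = Q.expectation (\<lambda>d. (\<Sum>i\<in>I. ?f i d * train_mean M f n d) / N)"
      using ifB by (subst integral_divide_zero) (simp add: Bochner_Integration.integral_sum)
    also have "\<dots> = Q.expectation (\<lambda>d. loo_mean f n d * train_mean M f n d)"
      by (simp add: mean sum_distrib_right)
    finally show ?thesis .
  qed
  have "Q.expectation (\<lambda>d. (loo_mean f n d - train_mean M f n d)\<^sup>2)
      = Q.expectation (\<lambda>d. loo_mean f n d * loo_mean f n d - 2 * (loo_mean f n d * train_mean M f n d) + train_mean M f n d * train_mean M f n d)"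
    by (simp add: power2_eq_square algebra_simps)
  also have "\<dots> = Q.expectation (\<lambda>d. loo_mean f n d * loo_mean f n d) - 2 * Q.expectation (\<lambda>d. loo_mean f n d * train_mean M f n d)
      + Q.expectation (\<lambda>d. train_mean M f n d * train_mean M f n d)"
  proof -
    have "integrable Q (\<lambda>d. loo_mean f n d * loo_mean f n d)" "integrable Q (\<lambda>d. loo_mean f n d * train_mean M f n d)"
      "integrable Q (\<lambda>d. train_mean M f n d * train_mean M f n d)"
      by (intro integrable_unit meas bounds)+
    then show ?thesis by simp
  qed
  also have "\<dots> \<le> 1 / N + (N - 1) / N * (q + 2 * instability) - 2 * ((N - 1) / N * (q - 2 * instability))
      + (q + 2 * instability)"
  proof (intro add_mono diff_mono mult_left_mono AA AB)
    show "Q.expectation (\<lambda>d. train_mean M f n d * train_mean M f n d) \<le> q + 2 * instability"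
      using BB by linarith
  qed simp
  also have "\<dots> = (1 + q) / N + 2 * instability + 6 * ((N - 1) / N * instability)"
    using N(1) by (simp add: field_simps)
  also have "\<dots> \<le> 2 / N + 2 * instability + 6 * (1 * instability)"
    using N(1) q1 i0 by (intro add_mono mult_left_mono mult_right_mono divide_right_mono) auto
  finally show ?thesis by (simp add: N_def)
qed

end

section \<open>Approximation of indicators by ramps\<close>

text \<open>
  For \<open>h > 0\<close>, the continuous function that is \<open>1\<close> up to \<open>s\<close>, \<open>0\<close> from \<open>s + h\<close> onwards and affine between.
\<close>

definition ramp :: "real \<Rightarrow> real \<Rightarrow> real \<Rightarrow> real" where
  "ramp s h x = max 0 (min 1 ((s + h - x) / h))"

lemma ramp_bounds: "0 \<le> ramp s h x" "ramp s h x \<le> 1"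
  by (auto simp: ramp_def)

lemma ramp_ge_of_bool: "h > 0 \<Longrightarrow> of_bool (x \<le> s) \<le> ramp s h x"
  by (auto simp: ramp_def max_def min_def field_simps)

lemma ramp_le_of_bool: "h > 0 \<Longrightarrow> ramp s h x \<le> of_bool (x \<le> s + h)"
  by (auto simp: ramp_def max_def min_def field_simps)

lemma ramp_Lipschitz:
  assumes "h > 0" shows "\<bar>ramp s h x - ramp s h y\<bar> \<le> \<bar>x - y\<bar> / h"
proof -
  have "\<bar>max 0 (min 1 a) - max 0 (min 1 b)\<bar> \<le> \<bar>a - b\<bar>" for a b :: real by linarith
  from this[of "(s + h - x) / h" "(s + h - y) / h"] show ?thesis
    using assms by (simp add: ramp_def diff_divide_distrib[symmetric] abs_minus_commute)
qed

lemma finite_grid: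
  fixes h L :: real assumes "h > 0"
  shows "\<exists>S. finite S \<and> (\<forall>x. \<bar>x\<bar> \<le> L \<longrightarrow> (\<exists>s\<in>S. x \<le> s \<and> s \<le> x + h))"
proof (intro exI conjI allI impI)
  let ?S = "(\<lambda>k::int. of_int k * h) ` {\<lceil>- L / h\<rceil>..\<lceil>L / h\<rceil>}"
  show "finite ?S" by simp
  fix x assume x: "\<bar>x\<bar> \<le> L"
  show "\<exists>s\<in>?S. x \<le> s \<and> s \<le> x + h"
  proof (intro bexI conjI)
    have "x / h \<le> of_int \<lceil>x / h\<rceil>" "of_int \<lceil>x / h\<rceil> \<le> x / h + 1" by linarith+
    then have "x / h * h \<le> of_int \<lceil>x / h\<rceil> * h" "of_int \<lceil>x / h\<rceil> * h \<le> (x / h + 1) * h"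
      using assms by (intro mult_right_mono; simp)+
    then show "x \<le> of_int \<lceil>x / h\<rceil> * h" "of_int \<lceil>x / h\<rceil> * h \<le> x + h"
      using assms by (simp_all add: distrib_right)
    have "- L / h \<le> x / h" "x / h \<le> L / h"
      using x assms by (intro divide_right_mono; linarith)+
    then show "of_int \<lceil>x / h\<rceil> * h \<in> ?S" by (intro imageI) (simp add: ceiling_mono)
  qed
qed

text \<open>
  Chebyshev's inequality for ramps of scores. A Lipschitz bound on the event that the two scores differ by at most
  \<open>\<kappa>\<close>, and the trivial bound off it, control the instability of the ramps.
\<close>

lemma loo_mean_ramp_deviation:
  fixes M :: "obs measure" and c c' :: score
  defines "Q \<equiv> \<lambda>n. tuple_space M (n + 1)"
  assumes M: "prob_space M" and n: "1 \<le> n"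
    and c: "conformity_score M n c" and c': "conformity_score M (n - 1) c'"
    and h: "h > 0" and e: "e > 0" and \<kappa>: "\<kappa> > 0"
  shows "measure (Q n) {d \<in> space (Q n). e \<le> \<bar>loo_mean (\<lambda>z \<tau>. ramp s h (c z \<tau>)) n d
              - train_mean M (\<lambda>z \<tau>. ramp s h (c z \<tau>)) n d\<bar>}
    \<le> (2 / real (n + 1) + 8 * (\<kappa> / h + measure (Q n) {d \<in> space (Q n).
          \<kappa> < \<bar>c (d (n + 1)) (restrict d {1..n}) - c' (d (n + 1)) (restrict d {1..n - 1})\<bar>})) / e\<^sup>2"
proof -
  let ?f = "\<lambda>z \<tau>. ramp s h (c z \<tau>)" and ?g = "\<lambda>z \<tau>. ramp s h (c' z \<tau>)"
  have rm: "ramp s h \<in> borel_measurable borel" unfolding ramp_def by measurable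
  interpret prob_space M by (rule M)
  interpret score_pair M n ?f ?g
  proof unfold_locales
    have "(\<lambda>x. ramp s h (case x of (z, \<tau>) \<Rightarrow> c z \<tau>)) \<in> borel_measurable (M \<Otimes>\<^sub>M tuple_space M n)"
      using c by (intro measurable_compose[OF _ rm]) (simp add: conformity_score_def)
    then show "conformity_score M n ?f"
      using c by (simp add: conformity_score_def case_prod_unfold)
    have "(\<lambda>x. ramp s h (case x of (z, \<tau>) \<Rightarrow> c' z \<tau>)) \<in> borel_measurable (M \<Otimes>\<^sub>M tuple_space M (n - 1))"
      using c' by (intro measurable_compose[OF _ rm]) (simp add: conformity_score_def)
    then show "(\<lambda>(z, \<tau>). ?g z \<tau>) \<in> borel_measurable (M \<Otimes>\<^sub>M tuple_space M (n - 1))"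
      by (simp add: case_prod_unfold)
  qed (use n ramp_bounds in auto)
  have QQ: "Q n = tuple_space M (n + 1)" by (simp add: Q_def)
  define D where "D = {d \<in> space (tuple_space M (n + 1)).
      \<kappa> < \<bar>c (d (n + 1)) (restrict d {1..n}) - c' (d (n + 1)) (restrict d {1..n - 1})\<bar>}"
  have cm: "(\<lambda>d. c'' (d (n + 1)) (restrict d {1..k})) \<in> borel_measurable (tuple_space M (n + 1))"
    if "conformity_score M k c''" "k \<le> n + 1" for k and c'' :: score
  proof -
    have "(\<lambda>d. (d (n + 1), restrict d {1..k})) \<in> tuple_space M (n + 1) \<rightarrow>\<^sub>M M \<Otimes>\<^sub>M tuple_space M k"
      using that(2) by (intro measurable_Pair measurable_tuple_component measurable_restrict_tuple) auto
    from measurable_compose[OF this, of "\<lambda>(z, \<tau>). c'' z \<tau>"] show ?thesis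
      using that(1) by (simp add: conformity_score_def)
  qed
  have [measurable]: "(\<lambda>d. c (d (n + 1)) (restrict d {1..n})) \<in> borel_measurable (tuple_space M (n + 1))"
    "(\<lambda>d. c' (d (n + 1)) (restrict d {1..n - 1})) \<in> borel_measurable (tuple_space M (n + 1))"
    using c c' by (intro cm; simp)+
  have D: "D \<in> sets (tuple_space M (n + 1))"
    unfolding D_def by measurable
  then have iD: "integrable (tuple_space M (n + 1)) (indicat_real D)"
    by (rule integrable_real_indicator) (simp only: Q.emeasure_eq_measure ennreal_less_top infinity_ennreal_def)
  have "instability \<le> Q.expectation (\<lambda>d. \<kappa> / h + indicator D d)"
    unfolding instability_def
  proof (rule integral_mono)
    have "\<bar>loo_score ?f n (n + 1) d - score' (n + 1) d\<bar> \<le> 1" for d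
      using bounds(1,2)[of "n + 1" d] bounds(3,4)[of "n + 1" d] by linarith
    then show "integrable (tuple_space M (n + 1)) (\<lambda>d. \<bar>loo_score ?f n (n + 1) d - score' (n + 1) d\<bar>)"
      using meas(1,2)[of "n + 1"] by (intro Q.integrable_const_bound[where B = 1] AE_I2) auto
    show "integrable (tuple_space M (n + 1)) (\<lambda>d. \<kappa> / h + indicat_real D d)"
      by (intro Bochner_Integration.integrable_add Q.integrable_const iD)
    fix d assume d: "d \<in> space (tuple_space M (n + 1))"
    show "\<bar>loo_score ?f n (n + 1) d - score' (n + 1) d\<bar> \<le> \<kappa> / h + indicator D d"
    proof (cases "d \<in> D")
      case True
      have "\<bar>loo_score ?f n (n + 1) d - score' (n + 1) d\<bar> \<le> 1"
        using bounds(1,2)[of "n + 1" d] bounds(3,4)[of "n + 1" d] by linarith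
      also have "\<dots> \<le> \<kappa> / h + 1" using h \<kappa> by simp
      finally show ?thesis using True by simp
    next
      case False
      have "\<bar>loo_score ?f n (n + 1) d - score' (n + 1) d\<bar>
          \<le> \<bar>c (d (n + 1)) (restrict d {1..n}) - c' (d (n + 1)) (restrict d {1..n - 1})\<bar> / h"
        unfolding loo_last score'_def by (rule ramp_Lipschitz[OF h])
      also have "\<dots> \<le> \<kappa> / h" using False d h by (intro divide_right_mono) (auto simp: D_def)
      finally show ?thesis using False by simp
    qed
  qed
  also have "\<dots> = \<kappa> / h + Q.prob D"
    using D iD by (subst Bochner_Integration.integral_add[OF Q.integrable_const iD]) (simp add: Q.prob_space[simplified])
  finally have inst: "instability \<le> \<kappa> / h + Q.prob D" .
  let ?Z = "\<lambda>d. (loo_mean ?f n d - train_mean M ?f n d)\<^sup>2"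
  have "\<bar>loo_mean ?f n d - train_mean M ?f n d\<bar> \<le> 1" for d
    using loo_mean_bounds[of d] train_mean_bounds[of d] by linarith
  then have "?Z d \<le> 1" for d by (simp add: abs_square_le_1)
  then have int: "integrable (tuple_space M (n + 1)) ?Z"
    using meas(3,5) by (intro Q.integrable_const_bound[where B = 1] AE_I2) auto
  have "{d \<in> space (Q n). e \<le> \<bar>loo_mean ?f n d - train_mean M ?f n d\<bar>} = {d \<in> space (Q n). e\<^sup>2 \<le> ?Z d}"
    using e by (auto simp: abs_le_square_iff[symmetric])
  then have "measure (Q n) {d \<in> space (Q n). e \<le> \<bar>loo_mean ?f n d - train_mean M ?f n d\<bar>} \<le> Q.expectation ?Z / e\<^sup>2"
    using integral_Markov_inequality_measure[OF int sets.empty_sets, of "e\<^sup>2"] e by (simp add: QQ)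
  also have "\<dots> \<le> (2 / real (n + 1) + 8 * (\<kappa> / h + Q.prob D)) / e\<^sup>2"
    using loo_mean_L2 inst by (intro divide_right_mono) auto
  finally show ?thesis by (simp add: D_def QQ)
qed

section \<open>Miscoverage and the conditional distribution function of the score\<close>

text \<open>
  Let \<open>G\<close> be the distribution function of \<open>X\<close>. The shift by \<open>\<eta>\<close> makes the bound hold in the
  presence of atoms: at a point \<open>z\<close> of the event \<open>G(X - \<eta>) \<ge> u\<close> where \<open>X\<close> is within \<open>\<eta>\<close> of its infimum over that
  event, the lower tail \<open>X \<le> X z - \<eta>\<close> has probability at least \<open>u\<close> and is disjoint from the event.
\<close>

lemma (in prob_space) prob_cdf_shift_le:
  fixes X :: "'a \<Rightarrow> real"
  assumes X: "X \<in> borel_measurable M" and "\<eta> > 0" "u \<le> 1"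
  shows "prob {z \<in> space M. u \<le> prob {w \<in> space M. X w \<le> X z - \<eta>}} \<le> 1 - u" (is "prob ?E \<le> _")
proof (cases "u \<le> 0 \<or> ?E = {} \<or> ?E \<notin> events")
  case True
  \<comment> \<open>If \<open>?E\<close> is not measurable, its measure is \<open>0\<close> by convention.\<close>
  moreover have ?thesis if "?E = {} \<or> ?E \<notin> events"
  proof -
    have "prob ?E = 0" using that
    proof
      assume "?E = {}"
      then show ?thesis by (simp only: measure_empty)
    qed (rule measure_notin_sets)
    then show ?thesis using \<open>u \<le> 1\<close> by linarith
  qed
  moreover have ?thesis if "u \<le> 0" using that prob_le_1[of ?E] by linarith
  ultimately show ?thesis by blast
next
  case False
  then have u: "u > 0" and ne: "?E \<noteq> {}" and E: "?E \<in> events" by auto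
  interpret X: real_distribution "distr M borel X"
    using X by (rule real_distribution_distr)
  have cdf: "cdf (distr M borel X) x = prob {w \<in> space M. X w \<le> x}" for x
    unfolding cdf_def using X by (subst measure_distr) (auto intro!: arg_cong[where f = prob])
  have "eventually (\<lambda>x. prob {w \<in> space M. X w \<le> x} < u) at_bot"
    using order_tendstoD(2)[OF X.cdf_lim_at_bot u] by (simp add: cdf)
  then obtain b where b: "prob {w \<in> space M. X w \<le> b} < u"
    using eventually_happens'[OF trivial_limit_at_bot_linorder] by blast
  \<comment> \<open>\<open>G\<close> vanishes at \<open>-\<infinity>\<close> and \<open>u > 0\<close>, so the event is bounded below.\<close>
  have bdd: "bdd_below (X ` ?E)"
  proof (rule bdd_belowI2)
    fix z assume z: "z \<in> ?E"
    show "b \<le> X z"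
    proof (rule ccontr)
      assume "\<not> b \<le> X z"
      then have "prob {w \<in> space M. X w \<le> X z - \<eta>} \<le> prob {w \<in> space M. X w \<le> b}"
        using X \<open>\<eta> > 0\<close> by (intro finite_measure_mono) auto
      with z b show False by auto
    qed
  qed
  obtain z where z: "z \<in> ?E" "X z < Inf (X ` ?E) + \<eta>"
    using cInf_lessD[of "X ` ?E" "Inf (X ` ?E) + \<eta>"] ne \<open>\<eta> > 0\<close> by auto
  have low: "{w \<in> space M. X w \<le> X z - \<eta>} \<in> events" using X by measurable
  have "{w \<in> space M. X w \<le> X z - \<eta>} \<inter> ?E = {}"
  proof -
    have "X z - \<eta> < X w" if "w \<in> ?E" for w
      using cInf_lower[OF imageI[OF that] bdd] z(2) by linarith
    then show ?thesis by force
  qed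
  then have "prob {w \<in> space M. X w \<le> X z - \<eta>} + prob ?E = prob ({w \<in> space M. X w \<le> X z - \<eta>} \<union> ?E)"
    using low E by (simp add: finite_measure_Union)
  also have "\<dots> \<le> 1" by simp
  finally show ?thesis using z(1) by auto
qed

text \<open>
  In terms of the whole sample \<open>d\<close>, \<open>F_hat\<close> at the true response is the empirical distribution function of
  the leave-one-out scores.
\<close>

lemma miscoverage_loo:
  assumes "d \<in> miscoverage Y p c n \<alpha> \<delta>"
  shows "(\<Sum>i\<in>{1..n + 1}. of_bool (loo_score c n i d \<le> loo_score c n (n + 1) d - \<delta>)) / real (n + 1) \<ge> 1 - \<alpha>"
proof -
  define R where "R = loo_score c n (n + 1) d"
  let ?x = "snd (d (n + 1))" and ?y = "fst (d (n + 1))" and ?\<tau> = "restrict d {1..n}"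
  have d: "d \<in> space (tuple_space (obs_space Y p) (n + 1))"
    and not: "?y \<notin> PS_fc Y c n \<alpha> \<delta> ?\<tau> ?x"
    using assms by (auto simp: miscoverage_def)
  \<comment> \<open>At the true response the augmented sample is the full sample.\<close>
  have aug: "augmented n ?\<tau> ?x ?y = d"
    using d by (auto simp: augmented_def fun_eq_iff restrict_def tuple_space_def space_PiM PiE_def extensional_def)
  have R: "c (?y, ?x) ?\<tau> = R"
    by (simp add: R_def loo_score_def drop_last_entry)
  have F: "F_hat c n ?\<tau> ?x ?y s = (\<Sum>i\<in>{1..n + 1}. of_bool (loo_score c n i d \<le> s)) / real (n + 1)" for s
  proof -
    have "{1..n + 1} = insert (n + 1) {1..n}" by auto
    then have "(\<Sum>i\<in>{1..n + 1}. of_bool (loo_score c n i d \<le> s))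
        = of_bool (R \<le> s) + (\<Sum>i\<in>{1..n}. of_bool (loo_score c n i d \<le> s) :: real)"
      by (simp only:) (subst sum.insert, auto simp: R_def)
    moreover have "(\<Sum>i=1..n. of_bool (c (?\<tau> i) (drop_entry (n + 1) i d) \<le> s))
        = (\<Sum>i\<in>{1..n}. of_bool (loo_score c n i d \<le> s) :: real)"
      by (intro sum.cong refl) (simp add: loo_score_def)
    ultimately show ?thesis unfolding F_hat_def aug R by (simp add: add_divide_distrib)
  qed
  have "d (n + 1) \<in> space (obs_space Y p)"
    using measurable_space[OF measurable_tuple_component[of "n + 1" "n + 1"] d] by simp
  then have "?y \<in> Y" by (auto simp: obs_space_def space_pair_measure space_restrict_space)
  with not have "quantile (F_hat c n ?\<tau> ?x ?y) (1 - \<alpha>) + ereal \<delta> < ereal (c (?y, ?x) ?\<tau>)"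
    by (simp add: PS_fc_def not_le)
  then have "quantile (F_hat c n ?\<tau> ?x ?y) (1 - \<alpha>) < ereal (R - \<delta>)"
    unfolding R by (cases "quantile (F_hat c n ?\<tau> ?x ?y) (1 - \<alpha>)") auto
  then obtain s where "F_hat c n ?\<tau> ?x ?y s \<ge> 1 - \<alpha>" "s < R - \<delta>"
    unfolding quantile_def Inf_less_iff by auto
  note this(1)
  also have "F_hat c n ?\<tau> ?x ?y s \<le> F_hat c n ?\<tau> ?x ?y (R - \<delta>)"
    unfolding F using \<open>s < R - \<delta>\<close> by (intro divide_right_mono sum_mono) auto
  finally show ?thesis unfolding F R_def .
qed

text \<open>
  Passage from the empirical to the conditional distribution function, by way of the ramp at a grid point \<open>s\<close>.
  The inflation \<open>\<delta>\<close> pays for it: a quarter for the rounding to the grid, a quarter for the width of the ramp, and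
  half remains in the conclusion.
\<close>

lemma miscoverage_imp_cdf:
  fixes M :: "obs measure"
  assumes M: "prob_space M"
    and d: "d \<in> space (tuple_space M (n + 1))"
    and c: "(\<lambda>(z, \<tau>). c z \<tau>) \<in> borel_measurable (M \<Otimes>\<^sub>M tuple_space M n)"
    and mis: "d \<in> miscoverage Y p c n \<alpha> \<delta>" and \<delta>: "\<delta> > 0"
    and s: "loo_score c n (n + 1) d - \<delta> \<le> s" "s \<le> loo_score c n (n + 1) d - \<delta> + \<delta> / 4"
    and close: "loo_mean (\<lambda>z \<tau>. ramp s (\<delta> / 4) (c z \<tau>)) n d
        \<le> train_mean M (\<lambda>z \<tau>. ramp s (\<delta> / 4) (c z \<tau>)) n d + e"
  shows "1 - \<alpha> - e \<le> measure M {w \<in> space M. c w (restrict d {1..n}) \<le> loo_score c n (n + 1) d - \<delta> / 2}"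
proof -
  interpret prob_space M by (rule M)
  define R where "R = loo_score c n (n + 1) d"
  have h: "\<delta> / 4 > 0" using \<delta> by simp
  have m: "(\<lambda>z. c z (restrict d {1..n})) \<in> borel_measurable M"
    using measurable_compose[OF measurable_Pair2' c] measurable_space[OF measurable_restrict_tuple[of n "n + 1" M] d]
    by simp
  have "1 - \<alpha> \<le> (\<Sum>i\<in>{1..n + 1}. of_bool (loo_score c n i d \<le> R - \<delta>)) / real (n + 1)"
    using miscoverage_loo[OF mis] by (simp add: R_def)
  also have "\<dots> \<le> loo_mean (\<lambda>z \<tau>. ramp s (\<delta> / 4) (c z \<tau>)) n d"
    unfolding loo_mean_def
  proof (intro divide_right_mono sum_mono)
    fix i
    have "of_bool (loo_score c n i d \<le> R - \<delta>) \<le> (of_bool (loo_score c n i d \<le> s) :: real)"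
      using s by (auto simp: R_def)
    also have "\<dots> \<le> ramp s (\<delta> / 4) (loo_score c n i d)" by (rule ramp_ge_of_bool[OF h])
    finally show "of_bool (loo_score c n i d \<le> R - \<delta>) \<le> loo_score (\<lambda>z \<tau>. ramp s (\<delta> / 4) (c z \<tau>)) n i d"
      by (simp add: loo_score_def)
  qed simp
  also note close
  also have "train_mean M (\<lambda>z \<tau>. ramp s (\<delta> / 4) (c z \<tau>)) n d
      \<le> (\<integral>w. indicator {w \<in> space M. c w (restrict d {1..n}) \<le> R - \<delta> / 2} w \<partial>M)"
    unfolding train_mean_def
  proof (rule integral_mono)
    show "integrable M (\<lambda>w. ramp s (\<delta> / 4) (c w (restrict d {1..n})))"
      unfolding ramp_def
      using m by (intro integrable_const_bound[where B = 1] AE_I2) auto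
    show "integrable M (indicat_real {w \<in> space M. c w (restrict d {1..n}) \<le> R - \<delta> / 2})"
      using m by (intro integrable_real_indicator) (auto simp: emeasure_eq_measure)
    fix w assume w: "w \<in> space M"
    have "ramp s (\<delta> / 4) (c w (restrict d {1..n})) \<le> of_bool (c w (restrict d {1..n}) \<le> s + \<delta> / 4)"
      by (rule ramp_le_of_bool[OF h])
    also have "\<dots> \<le> indicator {w \<in> space M. c w (restrict d {1..n}) \<le> R - \<delta> / 2} w"
      using s \<delta> w by (auto simp: R_def indicator_def)
    finally show "ramp s (\<delta> / 4) (c w (restrict d {1..n}))
        \<le> indicator {w \<in> space M. c w (restrict d {1..n}) \<le> R - \<delta> / 2} w" .
  qed
  also have "\<dots> = prob {w \<in> space M. c w (restrict d {1..n}) \<le> R - \<delta> / 2}"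
    using m by simp
  finally show ?thesis by (simp add: R_def)
qed

section \<open>Regular conditional distributions\<close>

lemma regular_cond_distr_integral:
  assumes M: "prob_space M" and sub: "subalgebra M F" and X: "X \<in> M \<rightarrow>\<^sub>M S"
    and cond: "regular_cond_distr M F S X K" and A: "A \<in> sets S"
  shows "(\<lambda>\<omega>. measure (K \<omega>) A) \<in> borel_measurable F"
    and "\<And>\<omega>. \<omega> \<in> space M \<Longrightarrow> prob_space (K \<omega>)"
    and "integrable M (\<lambda>\<omega>. measure (K \<omega>) A)"
    and "B \<in> sets F \<Longrightarrow> (\<integral>\<omega>\<in>B. measure (K \<omega>) A \<partial>M) = measure M {\<omega> \<in> B. X \<omega> \<in> A}"
proof -
  interpret prob_space M by (rule M)
  interpret finite_measure_subalgebra M F by unfold_locales (rule sub)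
  have K: "K \<in> F \<rightarrow>\<^sub>M prob_algebra S" using cond by (simp add: regular_cond_distr_def)
  have sp: "space F = space M" using sub by (simp add: subalgebra_def)
  show m: "(\<lambda>\<omega>. measure (K \<omega>) A) \<in> borel_measurable F"
    using measurable_compose[OF K measurable_measure_prob_algebra[OF A]] .
  then have m': "(\<lambda>\<omega>. measure (K \<omega>) A) \<in> borel_measurable M"
    by (rule measurable_from_subalg[OF sub])
  show pK: "prob_space (K \<omega>)" if "\<omega> \<in> space M" for \<omega>
    using measurable_space[OF K, of \<omega>] that sp by (auto simp: space_prob_algebra)
  show "integrable M (\<lambda>\<omega>. measure (K \<omega>) A)"
    by (rule integrable_const_bound[where B = 1])
      (use m' pK in \<open>auto intro!: AE_I2 prob_space.prob_le_1\<close>)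
  assume B: "B \<in> sets F"
  have XA: "X -` A \<inter> space M \<in> sets M" using measurable_sets[OF X A] .
  have BM: "B \<in> sets M" using B sub by (auto simp: subalgebra_def)
  have "(\<integral>\<omega>\<in>B. measure (K \<omega>) A \<partial>M) = (\<integral>\<omega>\<in>B. real_cond_exp M F (indicator (X -` A \<inter> space M)) \<omega> \<partial>M)"
    using cond A m' BM by (intro set_lebesgue_integral_cong_AE) (auto simp: regular_cond_distr_def)
  also have "\<dots> = (\<integral>\<omega>\<in>B. indicator (X -` A \<inter> space M) \<omega> \<partial>M)"
    using XA B by (intro real_cond_exp_intA[symmetric] integrable_real_indicator) (auto simp: emeasure_eq_measure)
  also have "\<dots> = (\<integral>\<omega>. indicator {\<omega> \<in> B. X \<omega> \<in> A} \<omega> \<partial>M)"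
    unfolding set_lebesgue_integral_def using sets.sets_into_space[OF BM]
    by (intro Bochner_Integration.integral_cong) (auto simp: indicator_def)
  also have "\<dots> = measure M {\<omega> \<in> B. X \<omega> \<in> A}"
    using sets.sets_into_space[OF BM] by (simp add: Int_absorb1 Int_absorb2 subset_eq)
  finally show "(\<integral>\<omega>\<in>B. measure (K \<omega>) A \<partial>M) = measure M {\<omega> \<in> B. X \<omega> \<in> A}" .
qed

lemma regular_cond_distr_Markov:
  assumes M: "prob_space M" and sub: "subalgebra M F" and X: "X \<in> M \<rightarrow>\<^sub>M S"
    and cond: "regular_cond_distr M F S X K" and A: "A \<in> sets S" and a: "a > 0"
  shows "measure M {\<omega> \<in> space M. a \<le> measure (K \<omega>) A} \<le> measure M {\<omega> \<in> space M. X \<omega> \<in> A} / a"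
proof -
  note K = regular_cond_distr_integral[OF M sub X cond A]
  have "space M \<in> sets F" using sub by (metis sets.top subalgebra_def)
  from K(4)[OF this] have "(\<integral>\<omega>. measure (K \<omega>) A \<partial>M) = measure M {\<omega> \<in> space M. X \<omega> \<in> A}"
    by (simp add: set_integral_space[OF K(3)])
  then show ?thesis
    using integral_Markov_inequality_measure[OF K(3) sets.empty_sets, of a] a by simp
qed

text \<open>
  To bound a conditional probability it suffices to bound the probabilities of intersections with the
  conditioning events.
\<close>

lemma regular_cond_distr_AE_le:
  assumes M: "prob_space M" and sub: "subalgebra M F" and X: "X \<in> M \<rightarrow>\<^sub>M S"
    and cond: "regular_cond_distr M F S X K" and A: "A \<in> sets S"
    and le: "\<And>B. B \<in> sets F \<Longrightarrow> measure M {\<omega> \<in> B. X \<omega> \<in> A} \<le> r * measure M B"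
  shows "AE \<omega> in M. measure (K \<omega>) A \<le> r"
proof -
  interpret prob_space M by (rule M)
  note K = regular_cond_distr_integral[OF M sub X cond A]
  define B where "B = {\<omega> \<in> space F. r < measure (K \<omega>) A}"
  have B: "B \<in> sets F" unfolding B_def using K(1) by measurable
  then have BM: "B \<in> sets M" using sub by (auto simp: subalgebra_def)
  have int: "integrable M (\<lambda>\<omega>. indicator B \<omega> * measure (K \<omega>) A)" "integrable M (\<lambda>\<omega>. indicator B \<omega> * r)"
    using integrable_mult_indicator[OF BM K(3)] integrable_mult_indicator[OF BM, of "\<lambda>_. r"] by simp_all
  have "(\<integral>\<omega>. indicator B \<omega> * (measure (K \<omega>) A - r) \<partial>M)
      = (\<integral>\<omega>\<in>B. measure (K \<omega>) A \<partial>M) - (\<integral>\<omega>\<in>B. r \<partial>M)"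
    using int by (simp add: set_lebesgue_integral_def right_diff_distrib)
  also have "\<dots> \<le> 0"
    using K(4)[OF B] le[OF B] BM by (simp add: set_integral_const[OF BM] emeasure_eq_measure mult.commute)
  finally have le0: "(\<integral>\<omega>. indicator B \<omega> * (measure (K \<omega>) A - r) \<partial>M) \<le> 0" .
  have nn: "0 \<le> indicator B \<omega> * (measure (K \<omega>) A - r)" for \<omega>
    by (auto simp: B_def indicator_def)
  have "(\<integral>\<omega>. indicator B \<omega> * (measure (K \<omega>) A - r) \<partial>M) = 0"
    using le0 nn by (intro antisym) (auto intro: integral_nonneg)
  moreover have "integrable M (\<lambda>\<omega>. indicator B \<omega> * (measure (K \<omega>) A - r))"
    using int by (simp add: right_diff_distrib)
  ultimately have "AE \<omega> in M. indicator B \<omega> * (measure (K \<omega>) A - r) = 0"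
    using integral_nonneg_eq_0_iff_AE nn by blast
  then show ?thesis
    using AE_space by eventually_elim (use sub in \<open>auto simp: B_def indicator_def subalgebra_def split: if_splits\<close>)
qed

section \<open>Excess miscoverage at a fixed sample size\<close>

text \<open>
  A sample \<open>X\<close> of \<open>n + 1\<close> independent observations with distribution \<open>P\<close>, a conformity score \<open>c\<close> for training samples
  of size \<open>n\<close>, and a regular conditional distribution \<open>K\<close> of \<open>X\<close> given its first \<open>n\<close> entries.
\<close>

locale conformal_sample = prob_space M for M :: "'w measure" +
  fixes P :: "obs measure" and n :: nat and c :: score
    and X :: "'w \<Rightarrow> nat \<Rightarrow> obs" and K :: "'w \<Rightarrow> (nat \<Rightarrow> obs) measure"
  assumes P: "prob_space P"
    and X: "X \<in> M \<rightarrow>\<^sub>M tuple_space P (n + 1)"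
    and distr_X: "distr M (tuple_space P (n + 1)) X = tuple_space P (n + 1)"
    and c: "conformity_score P n c"
    and cond: "regular_cond_distr M
      (generated_algebra M (tuple_space P n) (\<lambda>\<omega>. restrict (X \<omega>) {1..n})) (tuple_space P (n + 1)) X K"
begin

abbreviation Q :: "(nat \<Rightarrow> obs) measure" where
  "Q \<equiv> tuple_space P (n + 1)"

abbreviation F :: "'w measure" where
  "F \<equiv> generated_algebra M (tuple_space P n) (\<lambda>\<omega>. restrict (X \<omega>) {1..n})"

sublocale P: prob_space P by (rule P)

sublocale Q: prob_space Q by (rule P.prob_space_tuple)

lemma training_measurable: "(\<lambda>\<omega>. restrict (X \<omega>) {1..n}) \<in> M \<rightarrow>\<^sub>M tuple_space P n"
  using measurable_compose[OF X measurable_restrict_tuple] by simp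

lemma sets_F: "B \<in> sets F \<longleftrightarrow>
    (\<exists>A\<in>sets (tuple_space P n). B = {\<omega> \<in> space M. restrict (X \<omega>) {1..n} \<in> A})"
  using measurable_space[OF training_measurable]
  by (auto simp: generated_algebra_def sets_vimage_algebra2 Pi_iff vimage_def Int_def conj_commute)

lemma subalgebra_F: "subalgebra M F"
  unfolding subalgebra_def
proof
  show "space F = space M" by (simp add: generated_algebra_def)
  show "sets F \<subseteq> sets M"
  proof
    fix B assume "B \<in> sets F"
    then obtain A where A: "A \<in> sets (tuple_space P n)" "B = {\<omega> \<in> space M. restrict (X \<omega>) {1..n} \<in> A}"
      unfolding sets_F by blast
    show "B \<in> sets M" unfolding A(2) using measurable_sets[OF training_measurable A(1)]
      by (simp add: vimage_def Int_def conj_commute)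
  qed
qed

lemma prob_X: "A \<in> sets Q \<Longrightarrow> prob {\<omega> \<in> space M. X \<omega> \<in> A} = Q.prob A"
  using measure_distr[OF X, of A] unfolding distr_X by (simp add: vimage_def Int_def conj_commute)

text \<open>
  The event \<open>G(R - \<eta>) \<ge> u\<close>, where \<open>R\<close> is the score of the last observation and \<open>G\<close> its
  conditional distribution function given the training sample.
\<close>

definition high_rank :: "real \<Rightarrow> real \<Rightarrow> (nat \<Rightarrow> obs) set" where
  "high_rank \<eta> u = {d \<in> space Q.
     u \<le> P.prob {w \<in> space P. c w (restrict d {1..n}) \<le> loo_score c n (n + 1) d - \<eta>}}"

lemma c_measurable: "(\<lambda>(z, \<tau>). c z \<tau>) \<in> borel_measurable (P \<Otimes>\<^sub>M tuple_space P n)"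
  using c by (simp add: conformity_score_def)

lemma cdf_measurable:
  "(\<lambda>(z, \<tau>). P.prob {w \<in> space P. c w \<tau> \<le> c z \<tau> - \<eta>}) \<in> borel_measurable (P \<Otimes>\<^sub>M tuple_space P n)"
proof -
  let ?N = "P \<Otimes>\<^sub>M (P \<Otimes>\<^sub>M tuple_space P n)"
  have "(\<lambda>x. (fst x, snd (snd x))) \<in> ?N \<rightarrow>\<^sub>M P \<Otimes>\<^sub>M tuple_space P n" by measurable
  from measurable_compose[OF this c_measurable]
  have [measurable]: "(\<lambda>x. c (fst x) (snd (snd x))) \<in> borel_measurable ?N" by simp
  from measurable_compose[OF measurable_snd c_measurable]
  have [measurable]: "(\<lambda>x. c (fst (snd x)) (snd (snd x))) \<in> borel_measurable ?N"
    by (simp add: case_prod_unfold)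
  let ?v = "\<lambda>w x. if c w (snd x) \<le> c (fst x) (snd x) - \<eta> then 1 else (0::real)"
  have "(\<lambda>(w, x). ?v w x) \<in> borel_measurable ?N"
    unfolding case_prod_unfold by measurable
  then have "(\<lambda>x. \<integral>w. ?v w x \<partial>P) \<in> borel_measurable (P \<Otimes>\<^sub>M tuple_space P n)"
    by (rule P.measurable_integral_first)
  moreover have "(\<integral>w. ?v w x \<partial>P) = (case x of (z, \<tau>) \<Rightarrow> P.prob {w \<in> space P. c w \<tau> \<le> c z \<tau> - \<eta>})" for x
  proof -
    have "(\<integral>w. ?v w x \<partial>P) = (\<integral>w. indicator {w \<in> space P. c w (snd x) \<le> c (fst x) (snd x) - \<eta>} w \<partial>P)"
      by (intro Bochner_Integration.integral_cong) (auto simp: indicator_def)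
    then show ?thesis by (simp add: case_prod_unfold Int_def conj_commute conj_left_commute)
  qed
  ultimately show ?thesis by simp
qed

lemma high_rank_sets: "high_rank \<eta> u \<in> sets Q"
proof -
  have "(\<lambda>d. (d (n + 1), restrict d {1..n})) \<in> Q \<rightarrow>\<^sub>M P \<Otimes>\<^sub>M tuple_space P n"
    by (intro measurable_Pair measurable_tuple_component measurable_restrict_tuple) auto
  from measurable_compose[OF this cdf_measurable[of \<eta>]]
  show ?thesis
    unfolding high_rank_def loo_score_def drop_last_entry by (intro borel_measurable_le) simp_all
qed

lemma prob_high_rank:
  assumes \<eta>: "\<eta> > 0" and u: "u \<le> 1"
  shows "AE \<omega> in M. measure (K \<omega>) (high_rank \<eta> u) \<le> 1 - u"
proof (rule regular_cond_distr_AE_le[OF prob_space_axioms subalgebra_F X cond high_rank_sets])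
  fix B assume "B \<in> sets F"
  then obtain A where A: "A \<in> sets (tuple_space P n)" and B: "B = {\<omega> \<in> space M. restrict (X \<omega>) {1..n} \<in> A}"
    unfolding sets_F by blast
  define v where "v = (\<lambda>z \<tau>. if u \<le> P.prob {w \<in> space P. c w \<tau> \<le> c z \<tau> - \<eta>} then 1 else (0::real))"
  have v: "(\<lambda>(z, \<tau>). v z \<tau>) \<in> borel_measurable (P \<Otimes>\<^sub>M tuple_space P n)"
    using cdf_measurable[of \<eta>] unfolding v_def case_prod_unfold by measurable
  have v01: "0 \<le> v z \<tau>" "v z \<tau> \<le> 1" for z \<tau> by (auto simp: v_def)
  define A' where "A' = {d \<in> space Q. restrict d {1..n} \<in> A}"
  have A': "A' \<in> sets Q"
    using measurable_sets[OF measurable_restrict_tuple[of n "n + 1" P] A]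
    by (simp add: A'_def vimage_def Int_def conj_commute)
  have "prob {\<omega> \<in> B. X \<omega> \<in> high_rank \<eta> u} = prob {\<omega> \<in> space M. X \<omega> \<in> A' \<inter> high_rank \<eta> u}"
    using measurable_space[OF X] by (intro arg_cong[where f = prob]) (auto simp: B A'_def)
  also have "\<dots> = Q.prob (A' \<inter> high_rank \<eta> u)"
    by (intro prob_X sets.Int A' high_rank_sets)
  also have "\<dots> = Q.expectation (indicator (A' \<inter> high_rank \<eta> u))"
    using A' high_rank_sets by simp
  also have "\<dots> = Q.expectation (\<lambda>d. indicator A (restrict d {1..n}) * v (d (n + 1)) (restrict d {1..n}))"
    by (intro Bochner_Integration.integral_cong)
      (auto simp: A'_def high_rank_def v_def indicator_def loo_score_def drop_last_entry)
  also have "\<dots> = Q.expectation (\<lambda>d. indicator A (restrict d {1..n}) * (\<integral>z. v z (restrict d {1..n}) \<partial>P))"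
    using A v v01 by (intro P.integral_last_entry) auto
  also have "\<dots> \<le> Q.expectation (\<lambda>d. indicator A' d * (1 - u))"
  proof (rule integral_mono)
    have r: "(\<lambda>d. restrict d {1..n}) \<in> Q \<rightarrow>\<^sub>M tuple_space P n" by (rule measurable_restrict_tuple) simp
    have m1: "(\<lambda>d. indicat_real A (restrict d {1..n})) \<in> borel_measurable Q"
      using measurable_compose[OF r borel_measurable_indicator[OF A]] .
    have m2: "(\<lambda>d. \<integral>z. v z (restrict d {1..n}) \<partial>P) \<in> borel_measurable Q"
      using measurable_compose[OF r P.measurable_integral_first[OF v]] .
    show "integrable Q (\<lambda>d. indicator A (restrict d {1..n}) * (\<integral>z. v z (restrict d {1..n}) \<partial>P))"
    proof (rule Q.integrable_const_bound[where B = 1])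
      show "AE d in Q. norm (indicator A (restrict d {1..n}) * (\<integral>z. v z (restrict d {1..n}) \<partial>P)) \<le> 1"
        using P.expectation_le_1[of "\<lambda>z. v z _", OF v01] by (intro AE_I2) (simp add: indicator_def)
    qed (use m1 m2 in measurable)
    show "integrable Q (\<lambda>d. indicator A' d * (1 - u))"
      using integrable_mult_indicator[OF A' Q.integrable_const, of "1 - u"] by simp
    fix d assume d: "d \<in> space Q"
    let ?\<tau> = "restrict d {1..n}"
    have "?\<tau> \<in> space (tuple_space P n)" using measurable_space[OF r d] .
    then have cm: "(\<lambda>z. c z ?\<tau>) \<in> borel_measurable P"
      using measurable_compose[OF measurable_Pair2' c_measurable] by simp
    have "(\<integral>z. v z ?\<tau> \<partial>P) = (\<integral>z. indicator {z \<in> space P. u \<le> P.prob {w \<in> space P. c w ?\<tau> \<le> c z ?\<tau> - \<eta>}} z \<partial>P)"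
      by (intro Bochner_Integration.integral_cong) (auto simp: indicator_def v_def)
    also have "\<dots> \<le> 1 - u"
      using P.prob_cdf_shift_le[OF cm \<eta> u] by (simp add: Int_def conj_commute conj_left_commute)
    finally show "indicator A ?\<tau> * (\<integral>z. v z ?\<tau> \<partial>P) \<le> indicator A' d * (1 - u)"
      using d by (simp add: A'_def indicator_def)
  qed
  also have "\<dots> = (1 - u) * Q.prob A'"
    using A' by simp
  also have "Q.prob A' = prob B"
    unfolding prob_X[OF A', symmetric] using measurable_space[OF X]
    by (intro arg_cong[where f = prob]) (auto simp: B A'_def)
  finally show "prob {\<omega> \<in> B. X \<omega> \<in> high_rank \<eta> u} \<le> (1 - u) * prob B" .
qed

text \<open>
  \<open>B\<close> is to be chosen such that \<open>|R| \<le> B\<close> with high probability for the score \<open>R\<close> of the new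
  observation; \<open>S\<close> is a grid of mesh \<open>\<delta> / 4\<close>
  for the threshold \<open>R - \<delta>\<close>.
\<close>

lemma excess_miscoverage_bound:
  assumes sets_P: "sets P = sets (obs_space Y p)"
    and \<delta>: "\<delta> > 0" and \<epsilon>: "\<epsilon> > 0" and S: "finite S"
    and grid: "\<And>x. \<bar>x\<bar> \<le> B + \<delta> \<Longrightarrow> \<exists>s\<in>S. x \<le> s \<and> s \<le> x + \<delta> / 4"
  shows "prob {\<omega> \<in> space M. \<epsilon> \<le> (SUP \<alpha>\<in>{0..1}. measure (K \<omega>) (miscoverage Y p c n \<alpha> \<delta>) - \<alpha>)}
    \<le> (Q.prob {d \<in> space Q. B < \<bar>loo_score c n (n + 1) d\<bar>}
       + (\<Sum>s\<in>S. Q.prob {d \<in> space Q. \<epsilon> / 8 \<le> \<bar>loo_mean (\<lambda>z \<tau>. ramp s (\<delta> / 4) (c z \<tau>)) n d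
            - train_mean P (\<lambda>z \<tau>. ramp s (\<delta> / 4) (c z \<tau>)) n d\<bar>})) / (\<epsilon> / 2)"
proof -
  define e where "e = \<epsilon> / 8"
  define W0 where "W0 = {d \<in> space Q. B < \<bar>loo_score c n (n + 1) d\<bar>}"
  define W1 where "W1 = (\<lambda>s. {d \<in> space Q. e \<le> \<bar>loo_mean (\<lambda>z \<tau>. ramp s (\<delta> / 4) (c z \<tau>)) n d
            - train_mean P (\<lambda>z \<tau>. ramp s (\<delta> / 4) (c z \<tau>)) n d\<bar>})"
  define W where "W = W0 \<union> (\<Union>s\<in>S. W1 s)"
  have W0: "W0 \<in> sets Q"
    using measurable_loo_score[OF c_measurable, of "n + 1"] unfolding W0_def by measurable
  have W1: "W1 s \<in> sets Q" for s
  proof -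
    let ?f = "\<lambda>z \<tau>. ramp s (\<delta> / 4) (c z \<tau>)"
    have "(\<lambda>x. ramp s (\<delta> / 4) (case x of (z, \<tau>) \<Rightarrow> c z \<tau>)) \<in> borel_measurable (P \<Otimes>\<^sub>M tuple_space P n)"
      using c_measurable unfolding ramp_def by measurable
    then have f: "(\<lambda>(z, \<tau>). ?f z \<tau>) \<in> borel_measurable (P \<Otimes>\<^sub>M tuple_space P n)"
      by (simp add: case_prod_unfold)
    have [measurable]: "loo_mean ?f n \<in> borel_measurable Q"
      unfolding loo_mean_def using measurable_loo_score[OF f]
      by (intro borel_measurable_divide borel_measurable_sum) auto
    have [measurable]: "train_mean P ?f n \<in> borel_measurable Q"
      unfolding train_mean_def
      by (rule measurable_compose[OF measurable_restrict_tuple P.measurable_integral_first[OF f]]) simp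
    show ?thesis unfolding W1_def by measurable
  qed
  have W: "W \<in> sets Q" unfolding W_def using W0 W1 S by auto
  \<comment> \<open>The bound on \<open>high_rank\<close> holds almost surely for each threshold. Rounding \<open>1 - \<alpha> - e\<close> to a finite
    grid \<open>U\<close> of mesh \<open>e\<close> makes it hold for all levels simultaneously, at the cost of another \<open>e\<close>.\<close>
  obtain U where U: "finite U" "\<And>x. \<bar>x\<bar> \<le> 1 + \<epsilon> \<Longrightarrow> \<exists>u\<in>U. x \<le> u \<and> u \<le> x + e"
    using finite_grid[of e "1 + \<epsilon>"] \<epsilon> by (auto simp: e_def)
  have "AE \<omega> in M. \<forall>u\<in>U \<inter> {..1}. measure (K \<omega>) (high_rank (\<delta> / 2) u) \<le> 1 - u"
    using prob_high_rank[of "\<delta> / 2"] U(1) \<delta> by (subst AE_finite_all) auto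
  then have "AE \<omega> in M. \<epsilon> \<le> (SUP \<alpha>\<in>{0..1}. measure (K \<omega>) (miscoverage Y p c n \<alpha> \<delta>) - \<alpha>)
      \<longrightarrow> \<epsilon> / 2 \<le> measure (K \<omega>) W"
    using AE_space
  proof eventually_elim
    case (elim \<omega>)
    have "\<omega> \<in> space F" using elim(2) subalgebra_F by (simp add: subalgebra_def)
    moreover have "K \<in> F \<rightarrow>\<^sub>M prob_algebra Q" using cond unfolding regular_cond_distr_def by (rule conjunct1)
    ultimately have "K \<omega> \<in> space (prob_algebra Q)" by (rule measurable_space[rotated])
    then have K: "prob_space (K \<omega>)" and sets_K: "sets (K \<omega>) = sets Q" by (auto simp: space_prob_algebra)
    interpret K: prob_space "K \<omega>" by (rule K)
    have "measure (K \<omega>) (miscoverage Y p c n \<alpha> \<delta>) - \<alpha> \<le> K.prob W + \<epsilon> / 4" if \<alpha>: "\<alpha> \<in> {0..1}" for \<alpha>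
    proof -
      have "\<bar>1 - \<alpha> - 2 * e\<bar> \<le> 1 + \<epsilon>" using \<alpha> \<epsilon> by (auto simp: e_def abs_le_iff)
      then obtain u where u: "u \<in> U" "1 - \<alpha> - 2 * e \<le> u" "u \<le> 1 - \<alpha> - e"
        using U(2)[of "1 - \<alpha> - 2 * e"] by auto
      then have u1: "u \<le> 1" using \<alpha> \<epsilon> by (auto simp: e_def)
      have "miscoverage Y p c n \<alpha> \<delta> \<subseteq> W \<union> high_rank (\<delta> / 2) u"
      proof
        fix d assume mis: "d \<in> miscoverage Y p c n \<alpha> \<delta>"
        then have "d \<in> space (tuple_space (obs_space Y p) (n + 1))" by (simp add: miscoverage_def)
        then have d: "d \<in> space Q"
          using sets_eq_imp_space_eq[OF sets_P] by (simp add: tuple_space_def space_PiM)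
        show "d \<in> W \<union> high_rank (\<delta> / 2) u"
        proof (cases "d \<in> W")
          case False
          let ?R = "loo_score c n (n + 1) d"
          have "\<bar>?R\<bar> \<le> B" using False d by (auto simp: W_def W0_def)
          then have "\<bar>?R - \<delta>\<bar> \<le> B + \<delta>" using \<delta> by linarith
          then obtain s where s: "s \<in> S" "?R - \<delta> \<le> s" "s \<le> ?R - \<delta> + \<delta> / 4" using grid by blast
          have "d \<notin> W1 s" using False s(1) by (auto simp: W_def)
          then have "loo_mean (\<lambda>z \<tau>. ramp s (\<delta> / 4) (c z \<tau>)) n d
              \<le> train_mean P (\<lambda>z \<tau>. ramp s (\<delta> / 4) (c z \<tau>)) n d + e"
            unfolding W1_def using d by auto
          from miscoverage_imp_cdf[OF P d c_measurable mis \<delta> s(2,3) this] u(3) d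
          show ?thesis by (simp add: high_rank_def)
        qed simp
      qed
      \<comment> \<open>Again only the larger set has to be measurable.\<close>
      then have "K.prob (miscoverage Y p c n \<alpha> \<delta>) \<le> K.prob (W \<union> high_rank (\<delta> / 2) u)"
        using W high_rank_sets sets_K by (intro K.finite_measure_mono) auto
      also have "\<dots> \<le> K.prob W + K.prob (high_rank (\<delta> / 2) u)"
        using W high_rank_sets sets_K by (intro measure_Un_le) auto
      also have "K.prob (high_rank (\<delta> / 2) u) \<le> 1 - u" using elim(1) u(1) u1 by auto
      finally show ?thesis using u(2) by (simp add: e_def)
    qed
    then have "(SUP \<alpha>\<in>{0..1}. measure (K \<omega>) (miscoverage Y p c n \<alpha> \<delta>) - \<alpha>) \<le> K.prob W + \<epsilon> / 4"
      by (intro cSUP_least) auto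
    then show ?case using \<epsilon> by linarith
  qed
  \<comment> \<open>The supremum over uncountably many levels need not be measurable. A set outside the \<open>\<sigma>\<close>-algebra has
    measure \<open>0\<close>, so that monotonicity only needs measurability of the larger set.\<close>
  then have "prob {\<omega> \<in> space M. \<epsilon> \<le> (SUP \<alpha>\<in>{0..1}. measure (K \<omega>) (miscoverage Y p c n \<alpha> \<delta>) - \<alpha>)}
      \<le> prob {\<omega> \<in> space M. \<epsilon> / 2 \<le> measure (K \<omega>) W}"
    using measurable_from_subalg[OF subalgebra_F
        regular_cond_distr_integral(1)[OF prob_space_axioms subalgebra_F X cond W]]
    by (intro finite_measure_mono_AE) auto
  also have "\<dots> \<le> prob {\<omega> \<in> space M. X \<omega> \<in> W} / (\<epsilon> / 2)"
    by (rule regular_cond_distr_Markov[OF prob_space_axioms subalgebra_F X cond W]) (use \<epsilon> in simp)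
  also have "prob {\<omega> \<in> space M. X \<omega> \<in> W} = Q.prob W" by (rule prob_X[OF W])
  also have "Q.prob W \<le> Q.prob W0 + (\<Sum>s\<in>S. Q.prob (W1 s))"
  proof -
    have "Q.prob W \<le> Q.prob W0 + Q.prob (\<Union>s\<in>S. W1 s)"
      unfolding W_def using W0 W1 S by (intro measure_Un_le) auto
    also have "Q.prob (\<Union>s\<in>S. W1 s) \<le> (\<Sum>s\<in>S. Q.prob (W1 s))"
      using W1 S by (intro measure_UNION_le) auto
    finally show ?thesis by simp
  qed
  finally show ?thesis using \<epsilon> by (simp add: W0_def W1_def e_def divide_right_mono)
qed

end

section \<open>Convergence\<close>

lemma sets_tuple_space_cong:
  "sets P = sets Z \<Longrightarrow> sets (tuple_space P m) = sets (tuple_space Z m)"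
  unfolding tuple_space_def by (intro sets_PiM_cong) auto

lemma conformity_score_cong:
  assumes "sets P = sets Z" shows "conformity_score P m c \<longleftrightarrow> conformity_score Z m c"
proof -
  note T = sets_tuple_space_cong[OF assms, of m]
  have "sets (P \<Otimes>\<^sub>M tuple_space P m) = sets (Z \<Otimes>\<^sub>M tuple_space Z m)"
    using assms T by (rule sets_pair_measure_cong)
  then show ?thesis
    unfolding conformity_score_def
    by (simp add: sets_eq_imp_space_eq[OF assms] sets_eq_imp_space_eq[OF T] cong: measurable_cong_sets)
qed

lemma regular_cond_distr_cong:
  assumes "sets S = sets S'" shows "regular_cond_distr M F S X K \<longleftrightarrow> regular_cond_distr M F S' X K"
  unfolding regular_cond_distr_def prob_algebra_def subprob_algebra_cong[OF assms] assms ..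

lemma generated_algebra_cong:
  assumes "sets S = sets S'" shows "generated_algebra M S T = generated_algebra M S' T"
  unfolding generated_algebra_def vimage_algebra_def assms ..

lemma iid_conformal_sample:
  assumes M: "prob_space M" and P: "prob_space P" and PZ: "sets P = sets Z"
    and indep: "prob_space.indep_vars M (\<lambda>_. Z) t {1..n + 1}"
    and ident: "\<And>i. i \<in> {1..n + 1} \<Longrightarrow> distr M Z (t i) = P"
    and c: "conformity_score Z n c"
    and cond: "regular_cond_distr M (generated_algebra M (tuple_space Z n) (sample t n))
      (tuple_space Z (n + 1)) (sample t (n + 1)) K"
  shows "conformal_sample M P n c (sample t (n + 1)) K"
proof -
  interpret prob_space M by (rule M)
  note T = sets_tuple_space_cong[OF PZ]
  have rv: "t i \<in> M \<rightarrow>\<^sub>M Z" if "i \<in> {1..n + 1}" for i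
    using indep that unfolding indep_vars_def by auto
  have "sample t (n + 1) \<in> M \<rightarrow>\<^sub>M tuple_space Z (n + 1)"
    unfolding sample_def tuple_space_def by (intro measurable_restrict rv)
  then have X: "sample t (n + 1) \<in> M \<rightarrow>\<^sub>M tuple_space P (n + 1)"
    by (simp only: measurable_cong_sets[OF refl T])
  have "distr M (tuple_space P (n + 1)) (sample t (n + 1)) = distr M (tuple_space Z (n + 1)) (sample t (n + 1))"
    by (intro distr_cong T refl)
  also have "\<dots> = (\<Pi>\<^sub>M i\<in>{1..n + 1}. distr M Z (t i))"
    unfolding sample_def tuple_space_def
    using indep rv by (subst indep_vars_iff_distr_eq_PiM'[symmetric]) auto
  also have "\<dots> = tuple_space P (n + 1)"
    unfolding tuple_space_def using ident by (intro PiM_cong) auto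
  finally have D: "distr M (tuple_space P (n + 1)) (sample t (n + 1)) = tuple_space P (n + 1)" .
  have "(\<lambda>\<omega>. restrict (sample t (n + 1) \<omega>) {1..n}) = sample t n"
    by (auto simp: sample_def fun_eq_iff restrict_def)
  with cond have "regular_cond_distr M
      (generated_algebra M (tuple_space P n) (\<lambda>\<omega>. restrict (sample t (n + 1) \<omega>) {1..n}))
      (tuple_space P (n + 1)) (sample t (n + 1)) K"
    by (simp only: generated_algebra_cong[OF T] regular_cond_distr_cong[OF T])
  with X D c P show ?thesis
    by (intro conformal_sample.intro conformal_sample_axioms.intro prob_space_axioms)
      (simp_all only: conformity_score_cong[OF PZ])
qed

text \<open>
  A sequence tends to \<open>0\<close> if it is bounded by null sequences up to an arbitrarily small constant.
\<close>

lemma tendsto_0_by_slack: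
  fixes x :: "nat \<Rightarrow> real" and b :: "real \<Rightarrow> nat \<Rightarrow> real"
  assumes nonneg: "\<And>n. 0 \<le> x n" and c: "c \<ge> 0"
    and le: "\<And>\<kappa>. \<kappa> > 0 \<Longrightarrow> eventually (\<lambda>n. x n \<le> c * \<kappa> + b \<kappa> n) sequentially"
    and b: "\<And>\<kappa>. \<kappa> > 0 \<Longrightarrow> b \<kappa> \<longlonglongrightarrow> 0"
  shows "x \<longlonglongrightarrow> 0"
proof (rule order_tendstoI)
  fix r :: real assume r: "0 < r"
  define \<kappa> where "\<kappa> = r / (2 * (c + 1))"
  have \<kappa>: "\<kappa> > 0" "c * \<kappa> \<le> r / 2" using r c by (auto simp: \<kappa>_def field_simps)
  have "eventually (\<lambda>n. b \<kappa> n < r / 2) sequentially"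
    using order_tendstoD(2)[OF b[OF \<kappa>(1)], of "r / 2"] r by simp
  with le[OF \<kappa>(1)] show "eventually (\<lambda>n. x n < r) sequentially"
    by eventually_elim (use \<kappa>(2) in linarith)
qed (use nonneg in \<open>auto intro!: always_eventually intro: less_le_trans\<close>)

theorem theorem3p5:
  fixes Y :: "nat \<Rightarrow> real set"
    and p :: "nat \<Rightarrow> nat"
    and P :: "nat \<Rightarrow> obs measure"
    and M :: "nat \<Rightarrow> 'w measure"
    and t :: "nat \<Rightarrow> nat \<Rightarrow> 'w \<Rightarrow> obs"
    and C :: "nat \<Rightarrow> nat \<Rightarrow> score"
    and K :: "nat \<Rightarrow> 'w \<Rightarrow> (nat \<Rightarrow> obs) measure"
  assumes interval: "\<And>n. is_interval (Y n)"
    and P_prob: "\<And>n. prob_space (P n)"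
    and P_sets: "\<And>n. sets (P n) = sets (obs_space (Y n) (p n))"
    and M_prob: "\<And>n. prob_space (M n)"
    and indep: "\<And>n. prob_space.indep_vars (M n) (\<lambda>_. obs_space (Y n) (p n)) (t n) {1..n + 1}"
    and ident: "\<And>n i. i \<in> {1..n + 1} \<Longrightarrow> distr (M n) (obs_space (Y n) (p n)) (t n i) = P n"
    and scores: "\<And>n m. conformity_score (obs_space (Y n) (p n)) m (C n m)"
    and stable: "stable_scores M t C"
    and bounded: "stochastically_bounded M
                    (\<lambda>n \<omega>. C n n (t n (n + 1) \<omega>) (sample (t n) n \<omega>))"
    and cond: "\<And>n. regular_cond_distr (M n)
                 (generated_algebra (M n) (tuple_space (obs_space (Y n) (p n)) n) (sample (t n) n))
                 (tuple_space (obs_space (Y n) (p n)) (n + 1)) (sample (t n) (n + 1)) (K n)"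
  shows "\<forall>\<delta>>0. \<forall>\<epsilon>>0.
           (\<lambda>n. measure (M n) {\<omega> \<in> space (M n).
              (SUP \<alpha>\<in>{0..1}. measure (K n \<omega>) (miscoverage (Y n) (p n) (C n n) n \<alpha> \<delta>) - \<alpha>) \<ge> \<epsilon>})
           \<longlonglongrightarrow> 0"
proof (intro allI impI)
  fix \<delta> \<epsilon> :: real assume \<delta>: "\<delta> > 0" and \<epsilon>: "\<epsilon> > 0"
  define X where "X = (\<lambda>n. sample (t n) (n + 1))"
  define Q where "Q = (\<lambda>n. tuple_space (P n) (n + 1))"
  have sample: "conformal_sample (M n) (P n) n (C n n) (X n) (K n)" for n
    unfolding X_def
    by (rule iid_conformal_sample[OF M_prob P_prob P_sets indep ident scores cond])
  have scores': "conformity_score (P n) m (C n m)" for n m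
    using scores conformity_score_cong[OF P_sets] by blast
  have X_last: "X n \<omega> (n + 1) = t n (n + 1) \<omega>" "restrict (X n \<omega>) {1..n} = sample (t n) n \<omega>"
    "restrict (X n \<omega>) {1..n - 1} = drop_entry n n (sample (t n) n \<omega>)" for n \<omega>
    unfolding drop_last_entry by (auto simp: X_def sample_def fun_eq_iff restrict_def)
  have transfer: "measure (Q n) {d \<in> space (Q n). q d} = measure (M n) {\<omega> \<in> space (M n). q (X n \<omega>)}"
    if "{d \<in> space (Q n). q d} \<in> sets (Q n)" for n q
  proof -
    interpret S: conformal_sample "M n" "P n" n "C n n" "X n" "K n" by (rule sample)
    show ?thesis
      unfolding Q_def S.prob_X[OF that[unfolded Q_def], symmetric]
      using measurable_space[OF S.X] by (intro arg_cong[where f = "measure (M n)"]) auto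
  qed
  have score_m: "(\<lambda>d. C n k (d (n + 1)) (restrict d {1..k})) \<in> borel_measurable (Q n)" if "k \<le> n + 1" for n k
  proof -
    have "(\<lambda>d. (d (n + 1), restrict d {1..k})) \<in> Q n \<rightarrow>\<^sub>M P n \<Otimes>\<^sub>M tuple_space (P n) k"
      unfolding Q_def using that
      by (intro measurable_Pair measurable_tuple_component measurable_restrict_tuple) auto
    from measurable_compose[OF this, of "\<lambda>(z, \<tau>). C n k z \<tau>"] show ?thesis
      using scores'[of n k] by (simp add: conformity_score_def)
  qed
  \<comment> \<open>The probability that removing one training observation moves the new score by more than \<open>\<kappa>\<close>.\<close>
  define dev where "dev = (\<lambda>\<kappa> n. measure (Q n) {d \<in> space (Q n).
      \<kappa> < \<bar>C n n (d (n + 1)) (restrict d {1..n}) - C n (n - 1) (d (n + 1)) (restrict d {1..n - 1})\<bar>})"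
  have dev: "dev \<kappa> \<longlonglongrightarrow> 0" if "\<kappa> > 0" for \<kappa>
  proof -
    have "dev \<kappa> = (\<lambda>n. measure (M n) {\<omega> \<in> space (M n).
       \<kappa> < \<bar>C n n (t n (n + 1) \<omega>) (sample (t n) n \<omega>)
        - C n (n - 1) (t n (n + 1) \<omega>) (drop_entry n n (sample (t n) n \<omega>))\<bar>})"
    proof
      fix n
      have [measurable]: "(\<lambda>d. C n n (d (n + 1)) (restrict d {1..n})) \<in> borel_measurable (Q n)"
        "(\<lambda>d. C n (n - 1) (d (n + 1)) (restrict d {1..n - 1})) \<in> borel_measurable (Q n)"
        by (intro score_m; simp)+
      have "{d \<in> space (Q n). \<kappa> < \<bar>C n n (d (n + 1)) (restrict d {1..n})
          - C n (n - 1) (d (n + 1)) (restrict d {1..n - 1})\<bar>} \<in> sets (Q n)"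
        by measurable
      from transfer[OF this] show "dev \<kappa> n = measure (M n) {\<omega> \<in> space (M n).
       \<kappa> < \<bar>C n n (t n (n + 1) \<omega>) (sample (t n) n \<omega>)
        - C n (n - 1) (t n (n + 1) \<omega>) (drop_entry n n (sample (t n) n \<omega>))\<bar>}"
        unfolding dev_def X_last .
    qed
    then show ?thesis
      using stable that unfolding stable_scores_def tends_to_0_in_prob_def by simp
  qed
  \<comment> \<open>The probability that, for the ramp at \<open>s\<close>, leave-one-out mean and conditional mean differ noticeably.\<close>
  define emp where "emp = (\<lambda>s n. measure (Q n) {d \<in> space (Q n).
      \<epsilon> / 8 \<le> \<bar>loo_mean (\<lambda>z \<tau>. ramp s (\<delta> / 4) (C n n z \<tau>)) n d
        - train_mean (P n) (\<lambda>z \<tau>. ramp s (\<delta> / 4) (C n n z \<tau>)) n d\<bar>})"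
  have emp: "emp s \<longlonglongrightarrow> 0" for s
  proof (rule tendsto_0_by_slack)
    show "0 \<le> emp s n" for n by (simp add: emp_def)
    show "0 \<le> 8 / (\<delta> / 4) / (\<epsilon> / 8)\<^sup>2" using \<delta> by simp
    fix \<kappa> :: real assume \<kappa>: "\<kappa> > 0"
    show "eventually (\<lambda>n. emp s n \<le> 8 / (\<delta> / 4) / (\<epsilon> / 8)\<^sup>2 * \<kappa>
        + (2 / real (n + 1) + 8 * dev \<kappa> n) / (\<epsilon> / 8)\<^sup>2) sequentially"
      using eventually_ge_at_top[of 1]
    proof eventually_elim
      case (elim n)
      have "emp s n \<le> (2 / real (n + 1) + 8 * (\<kappa> / (\<delta> / 4) + dev \<kappa> n)) / (\<epsilon> / 8)\<^sup>2"
        unfolding emp_def dev_def Q_def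
        using loo_mean_ramp_deviation[OF P_prob elim scores' scores',
            where h = "\<delta> / 4" and e = "\<epsilon> / 8" and \<kappa> = \<kappa> and s = s] \<delta> \<epsilon> \<kappa>
        by simp
      then show ?case by (simp add: add_divide_distrib algebra_simps)
    qed
    have "(\<lambda>n. (2 / real (n + 1) + 8 * dev \<kappa> n) / (\<epsilon> / 8)\<^sup>2) \<longlonglongrightarrow> (0 + 8 * 0) / (\<epsilon> / 8)\<^sup>2"
      by (intro tendsto_intros dev \<kappa> LIMSEQ_Suc[OF lim_const_over_n, of 2, simplified Suc_eq_plus1])
        (use \<epsilon> in simp)
    then show "(\<lambda>n. (2 / real (n + 1) + 8 * dev \<kappa> n) / (\<epsilon> / 8)\<^sup>2) \<longlonglongrightarrow> 0" by simp
  qed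
  let ?bad = "\<lambda>n. measure (M n) {\<omega> \<in> space (M n).
              (SUP \<alpha>\<in>{0..1}. measure (K n \<omega>) (miscoverage (Y n) (p n) (C n n) n \<alpha> \<delta>) - \<alpha>) \<ge> \<epsilon>}"
  show "?bad \<longlonglongrightarrow> 0"
  proof (rule order_tendstoI)
    fix r :: real assume r: "0 < r"
    obtain B where B: "\<And>n. measure (M n) {\<omega> \<in> space (M n). \<bar>C n n (t n (n + 1) \<omega>) (sample (t n) n \<omega>)\<bar> > B}
        \<le> r * \<epsilon> / 4"
      using bounded[unfolded stochastically_bounded_def, rule_format, of "r * \<epsilon> / 4"] r \<epsilon> by auto
    have tight: "measure (Q n) {d \<in> space (Q n). B < \<bar>loo_score (C n n) n (n + 1) d\<bar>} \<le> r * \<epsilon> / 4" for n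
    proof -
      have [measurable]: "(\<lambda>d. C n n (d (n + 1)) (restrict d {1..n})) \<in> borel_measurable (Q n)"
        by (intro score_m) simp
      have "{d \<in> space (Q n). B < \<bar>C n n (d (n + 1)) (restrict d {1..n})\<bar>} \<in> sets (Q n)"
        by measurable
      from transfer[OF this] B[of n] show ?thesis
        unfolding loo_score_def drop_last_entry X_last by simp
    qed
    obtain S where S: "finite S" "\<And>x. \<bar>x\<bar> \<le> B + \<delta> \<Longrightarrow> \<exists>s\<in>S. x \<le> s \<and> s \<le> x + \<delta> / 4"
      using finite_grid[of "\<delta> / 4" "B + \<delta>"] \<delta> by auto
    have "(\<lambda>n. \<Sum>s\<in>S. emp s n) \<longlonglongrightarrow> (\<Sum>s\<in>S. 0)" by (intro tendsto_sum emp)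
    then have "eventually (\<lambda>n. (\<Sum>s\<in>S. emp s n) < r * \<epsilon> / 4) sequentially"
      using r \<epsilon> by (intro order_tendstoD(2)) auto
    then show "eventually (\<lambda>n. ?bad n < r) sequentially"
    proof eventually_elim
      case (elim n)
      interpret S: conformal_sample "M n" "P n" n "C n n" "X n" "K n" by (rule sample)
      have "?bad n \<le> (measure (Q n) {d \<in> space (Q n). B < \<bar>loo_score (C n n) n (n + 1) d\<bar>}
          + (\<Sum>s\<in>S. emp s n)) / (\<epsilon> / 2)"
        unfolding emp_def Q_def
        by (rule S.excess_miscoverage_bound[OF P_sets \<delta> \<epsilon> S])
      also have "\<dots> < (r * \<epsilon> / 4 + r * \<epsilon> / 4) / (\<epsilon> / 2)"
        using tight[of n] elim \<epsilon> by (intro divide_strict_right_mono add_le_less_mono) simp_all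
      also have "\<dots> = r" using \<epsilon> by simp
      finally show ?case .
    qed
  qed (auto intro!: always_eventually intro: less_le_trans[OF _ measure_nonneg])
qed

end
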